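(* Let $1\le m\le n$, let $I$ be a holonomic left ideal of $D$, and let $J=(I+\partial_1 D+\cdots+\partial_m D)\cap D'\subset D'$ be the integration ideal of $I$ with respect to $x_1,\ldots,x_m$. For any $p\in J$, there exists an algorithm to compute differential operators $p_i\in D$ $(1\le i\le m)$ such that $$p-\sum_{i=1}^m \partial_i p_i\in I .$$
   Context: $K$ is $\mathbb{Q}$ or $\mathbb{C}$. $D=K\langle x_1,\ldots,x_n,\partial_1,\ldots,\partial_n\rangle$ is the Weyl algebra in $n$ variables over $K$, where $\partial_i$ is the differential operator standing for $x_i$ (so $\partial_i x_j-x_j\partial_i=\delta_{ij}$, the $x_i$ commute with each other and the $\partial_i$ commute with each other). $D'=K\langle x_{m+1},\ldots,x_n,\partial_{m+1},\ldots,\partial_n\rangle$ is the Weyl algebra in the last $n-m$ variables, regarded as a subring of $D$. A left ideal $I\subset D$ is holonomic if $D/I$ is a holonomic left $D$-module. Here $\partial_i D=\{\partial_i P \mid P\in D\}$ is the right ideal generated by $\partial_i$. The integration ideal of $I$ with respect to $x_1,\ldots,x_m$ is the left $D'$-ideal $(I+\partial_1 D+\cdots+\partial_m D)\cap D'$. The algorithm is given a finite set of generators of $I$. The operators $p_1,\ldots,p_m$ are called inhomogeneous parts of $p$. *)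

theory Defs
  imports Complex_Main "HOL-Library.Set_Algebras" "HOL-Computational_Algebra.Polynomial"
begin

text \<open>
  The type \<open>'k weyl\<close> is the associative unital algebra over the field \<open>'k\<close> presented by
  generators \<open>x\<^sub>i\<close>, \<open>\<partial>\<^sub>i\<close> (for all natural numbers \<open>i\<close>) and the Weyl relations. It is
  the quotient of the type of formal expressions by the least congruence that contains the laws of
  an associative unital algebra and these relations. The Weyl algebra in \<open>n\<close> variables is the
  subalgebra generated by \<open>x\<^sub>i\<close>, \<open>\<partial>\<^sub>i\<close> for \<open>1 \<le> i \<le> n\<close>. (The inclusion of the
  \<open>n\<close>-variable algebra into the one with all variables is injective, because both have a basis
  of normally ordered monomials.)
\<close>

datatype 'k wexpr =
    WConst 'k
  | WX nat
  | WD nat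
  | WPlus "'k wexpr" "'k wexpr"
  | WTimes "'k wexpr" "'k wexpr"

inductive weq :: "'k::field wexpr \<Rightarrow> 'k wexpr \<Rightarrow> bool" where
  refl: "weq a a"
| sym: "weq a b \<Longrightarrow> weq b a"
| trans: "weq a b \<Longrightarrow> weq b c \<Longrightarrow> weq a c"
| cong_plus: "weq a a' \<Longrightarrow> weq b b' \<Longrightarrow> weq (WPlus a b) (WPlus a' b')"
| cong_times: "weq a a' \<Longrightarrow> weq b b' \<Longrightarrow> weq (WTimes a b) (WTimes a' b')"
| plus_assoc: "weq (WPlus (WPlus a b) c) (WPlus a (WPlus b c))"
| plus_comm: "weq (WPlus a b) (WPlus b a)"
| plus_zero: "weq (WPlus (WConst 0) a) a"
| zero_times: "weq (WTimes (WConst 0) a) (WConst 0)"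
| times_assoc: "weq (WTimes (WTimes a b) c) (WTimes a (WTimes b c))"
| one_times: "weq (WTimes (WConst 1) a) a"
| times_one: "weq (WTimes a (WConst 1)) a"
| distrib_left: "weq (WTimes a (WPlus b c)) (WPlus (WTimes a b) (WTimes a c))"
| distrib_right: "weq (WTimes (WPlus a b) c) (WPlus (WTimes a c) (WTimes b c))"
| const_plus: "weq (WPlus (WConst s) (WConst t)) (WConst (s + t))"
| const_times: "weq (WTimes (WConst s) (WConst t)) (WConst (s * t))"
| const_central: "weq (WTimes (WConst s) a) (WTimes a (WConst s))"
| x_comm: "weq (WTimes (WX i) (WX j)) (WTimes (WX j) (WX i))"
| d_comm: "weq (WTimes (WD i) (WD j)) (WTimes (WD j) (WD i))"
| d_x: "weq (WTimes (WD i) (WX j))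
          (WPlus (WTimes (WX j) (WD i)) (WConst (if i = j then 1 else 0)))"

quotient_type (overloaded) 'k weyl = "'k::field wexpr" / weq
proof (rule equivpI)
  show "reflp (weq :: 'k wexpr \<Rightarrow> _)" by (simp add: reflpI weq.refl)
  show "symp (weq :: 'k wexpr \<Rightarrow> _)" by (auto intro: sympI weq.sym)
  show "transp (weq :: 'k wexpr \<Rightarrow> _)" by (auto intro: transpI weq.trans)
qed

text \<open>
  Action on formal power series in the variables \<open>x\<^sub>i\<close> (a function maps an exponent to its
  coefficient), used only to see that the algebra is not trivial.
\<close>

primrec wact :: "'k::field wexpr \<Rightarrow> ((nat \<Rightarrow> nat) \<Rightarrow> 'k) \<Rightarrow> (nat \<Rightarrow> nat) \<Rightarrow> 'k" where
  "wact (WConst s) f = (\<lambda>a. s * f a)"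
| "wact (WX i) f = (\<lambda>a. if a i = 0 then 0 else f (a(i := a i - 1)))"
| "wact (WD i) f = (\<lambda>a. of_nat (a i + 1) * f (a(i := a i + 1)))"
| "wact (WPlus P Q) f = (\<lambda>a. wact P f a + wact Q f a)"
| "wact (WTimes P Q) f = wact P (wact Q f)"

lemma wact_add: "wact P (\<lambda>a. f a + g a) = (\<lambda>a. wact P f a + wact P g a)"
proof (induction P arbitrary: f g)
  case (WTimes P Q)
  then show ?case by simp
qed (auto simp: fun_eq_iff algebra_simps)

lemma wact_scale: "wact P (\<lambda>a. s * f a) = (\<lambda>a. s * wact P f a)"
proof (induction P arbitrary: f)
  case (WTimes P Q)
  then show ?case by simp
qed (auto simp: fun_eq_iff algebra_simps)

lemma wact_weq: "weq P Q \<Longrightarrow> wact P = wact Q"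
proof (induction rule: weq.induct)
  case (cong_times a a' b b')
  then show ?case by (metis (no_types, lifting) ext wact.simps(5))
next
  case (x_comm i j)
  then show ?case by (cases "i = j") (auto simp: fun_eq_iff fun_upd_twist)
next
  case (d_comm i j)
  then show ?case by (cases "i = j") (auto simp: fun_eq_iff fun_upd_twist)
next
  case (d_x i j)
  then show ?case by (cases "i = j") (auto simp: fun_eq_iff fun_upd_twist algebra_simps)
qed (auto simp: fun_eq_iff wact_add wact_scale algebra_simps)

instantiation weyl :: (field) ring_1
begin

lift_definition zero_weyl :: "'a weyl" is "WConst 0" .
lift_definition one_weyl :: "'a weyl" is "WConst 1" .
lift_definition plus_weyl :: "'a weyl \<Rightarrow> 'a weyl \<Rightarrow> 'a weyl" is WPlus
  by (rule weq.cong_plus)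
lift_definition times_weyl :: "'a weyl \<Rightarrow> 'a weyl \<Rightarrow> 'a weyl" is WTimes
  by (rule weq.cong_times)
lift_definition uminus_weyl :: "'a weyl \<Rightarrow> 'a weyl" is "WTimes (WConst (-1))"
  by (rule weq.cong_times[OF weq.refl])
definition minus_weyl :: "'a weyl \<Rightarrow> 'a weyl \<Rightarrow> 'a weyl" where
  "minus_weyl P Q = P + - Q"

instance
proof
  fix a b c :: "'a weyl"
  show "a + b + c = a + (b + c)" by transfer (rule weq.plus_assoc)
  show "a + b = b + a" by transfer (rule weq.plus_comm)
  show "0 + a = a" by transfer (rule weq.plus_zero)
  show "a * b * c = a * (b * c)" by transfer (rule weq.times_assoc)
  show "1 * a = a" by transfer (rule weq.one_times)
  show "a * 1 = a" by transfer (rule weq.times_one)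
  show "(a + b) * c = a * c + b * c" by transfer (rule weq.distrib_right)
  show "a * (b + c) = a * b + a * c" by transfer (rule weq.distrib_left)
  show "a - b = a + - b" by (rule minus_weyl_def)
  show "- a + a = 0"
  proof transfer
    fix P :: "'a wexpr"
    let ?n = "WTimes (WConst (-1)) P"
    have "weq (WPlus ?n P) (WPlus ?n (WTimes (WConst 1) P))"
      by (intro weq.cong_plus weq.refl weq.sym[OF weq.one_times])
    moreover have "weq (WPlus ?n (WTimes (WConst 1) P)) (WTimes (WPlus (WConst (-1)) (WConst 1)) P)"
      by (rule weq.sym[OF weq.distrib_right])
    moreover have "weq (WTimes (WPlus (WConst (-1)) (WConst 1)) P) (WTimes (WConst 0) P)"
      using weq.cong_times[OF weq.const_plus[of "-1" "1::'a"] weq.refl] by simp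
    ultimately show "weq (WPlus ?n P) (WConst 0)"
      by (meson weq.trans weq.zero_times)
  qed
  show "(0 :: 'a weyl) \<noteq> 1"
  proof transfer
    have "wact (WConst 0) \<noteq> wact (WConst (1::'a))"
      by (auto simp: fun_eq_iff intro!: exI[of _ "\<lambda>_. 1"])
    then show "\<not> weq (WConst 0) (WConst (1::'a))"
      using wact_weq by blast
  qed
qed

end

lift_definition weyl_const :: "'k::field \<Rightarrow> 'k weyl" is WConst .
lift_definition weyl_x :: "nat \<Rightarrow> 'k::field weyl" is WX .
lift_definition weyl_d :: "nat \<Rightarrow> 'k::field weyl" ("\<partial>") is WD .

lemma weyl_const_0: "weyl_const 0 = 0" and weyl_const_1: "weyl_const 1 = 1"
  by (transfer, rule weq.refl)+

lemma weyl_relations: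
  "weyl_x i * weyl_x j = weyl_x j * weyl_x i"
  "\<partial> i * \<partial> j = \<partial> j * \<partial> i"
  "\<partial> i * weyl_x j - weyl_x j * \<partial> i = (if i = j then 1 else 0)"
proof -
  show "weyl_x i * weyl_x j = weyl_x j * weyl_x i" by transfer (rule weq.x_comm)
  show "\<partial> i * \<partial> j = \<partial> j * \<partial> i" by transfer (rule weq.d_comm)
  have "\<partial> i * weyl_x j = weyl_x j * \<partial> i + weyl_const (if i = j then 1 else 0)"
    by transfer (rule weq.d_x)
  then show "\<partial> i * weyl_x j - weyl_x j * \<partial> i = (if i = j then 1 else 0)"
    by (simp add: weyl_const_0 weyl_const_1 split: if_splits)
qed

definition weyl_scale :: "'k::field \<Rightarrow> 'k weyl \<Rightarrow> 'k weyl" where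
  "weyl_scale c P = weyl_const c * P"

global_interpretation weyl: vector_space weyl_scale
  defines weyl_span = weyl.span and weyl_dim = weyl.dim
proof
  fix s t :: 'a and P Q :: "'a weyl"
  have "weyl_const (s + t) = weyl_const s + weyl_const t"
    by transfer (rule weq.sym[OF weq.const_plus])
  then show "weyl_scale (s + t) P = weyl_scale s P + weyl_scale t P"
    by (simp add: weyl_scale_def ring_distribs)
  have "weyl_const (s * t) = weyl_const s * weyl_const t"
    by transfer (rule weq.sym[OF weq.const_times])
  then show "weyl_scale s (weyl_scale t P) = weyl_scale (s * t) P"
    by (simp add: weyl_scale_def mult.assoc)
  show "weyl_scale 1 P = P" by (simp add: weyl_scale_def weyl_const_1)
qed (simp add: weyl_scale_def ring_distribs)

inductive_set weyl_algebra :: "nat set \<Rightarrow> 'k::field weyl set" for S :: "nat set" where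
  "weyl_const c \<in> weyl_algebra S"
| "i \<in> S \<Longrightarrow> weyl_x i \<in> weyl_algebra S"
| "i \<in> S \<Longrightarrow> \<partial> i \<in> weyl_algebra S"
| "P \<in> weyl_algebra S \<Longrightarrow> Q \<in> weyl_algebra S \<Longrightarrow> P + Q \<in> weyl_algebra S"
| "P \<in> weyl_algebra S \<Longrightarrow> Q \<in> weyl_algebra S \<Longrightarrow> P * Q \<in> weyl_algebra S"

definition left_ideal :: "'a::ring_1 set \<Rightarrow> 'a set \<Rightarrow> bool" where
  "left_ideal D I \<longleftrightarrow> I \<subseteq> D \<and> 0 \<in> I \<and> (\<forall>a\<in>I. \<forall>b\<in>I. a + b \<in> I) \<and> (\<forall>P\<in>D. \<forall>a\<in>I. P * a \<in> I)"

definition left_ideal_generated :: "'a::ring_1 set \<Rightarrow> 'a set \<Rightarrow> 'a set" where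
  "left_ideal_generated D F = left_ideal D hull F"

text \<open>The monomial \<open>x\<^sub>1\<^bsup>\<alpha>\<^sub>1\<^esup>\<dots>x\<^sub>n\<^bsup>\<alpha>\<^sub>n\<^esup> \<partial>\<^sub>1\<^bsup>\<beta>\<^sub>1\<^esup>\<dots>\<partial>\<^sub>n\<^bsup>\<beta>\<^sub>n\<^esup>\<close>; list positions count from \<open>0\<close>.\<close>

definition weyl_monomial :: "nat list \<Rightarrow> nat list \<Rightarrow> 'k::field weyl" where
  "weyl_monomial \<alpha> \<beta> =
     (\<Prod>i\<leftarrow>[0..<length \<alpha>]. weyl_x (Suc i) ^ (\<alpha> ! i)) *
     (\<Prod>i\<leftarrow>[0..<length \<beta>]. \<partial> (Suc i) ^ (\<beta> ! i))"

definition bernstein_filtration :: "nat \<Rightarrow> nat \<Rightarrow> 'k::field weyl set" where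
  "bernstein_filtration n k =
     weyl_span {weyl_monomial \<alpha> \<beta> | \<alpha> \<beta>.
       length \<alpha> = n \<and> length \<beta> = n \<and> sum_list \<alpha> + sum_list \<beta> \<le> k}"

text \<open>
  The Bernstein filtration \<open>B\<^sub>k\<close> of \<open>D\<close> induces the good filtration
  \<open>(B\<^sub>k + I)/I = B\<^sub>k/(B\<^sub>k \<inter> I)\<close> of \<open>D/I\<close>; the degree of its Hilbert polynomial is the
  dimension of \<open>D/I\<close>. The module is holonomic if it is zero or its dimension is \<open>n\<close>.
\<close>

definition hilbert_function :: "nat \<Rightarrow> 'k::field weyl set \<Rightarrow> nat \<Rightarrow> nat" where
  "hilbert_function n (I :: 'k weyl set) k =
     weyl_dim (bernstein_filtration n k :: 'k weyl set) - weyl_dim (bernstein_filtration n k \<inter> I)"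

definition holonomic_ideal :: "nat \<Rightarrow> 'k::field weyl set \<Rightarrow> bool" where
  "holonomic_ideal n I \<longleftrightarrow>
     left_ideal (weyl_algebra {1..n}) I \<and>
     (I = weyl_algebra {1..n} \<or>
      (\<exists>h :: rat poly. degree h = n \<and>
         (\<forall>\<^sub>F k in sequentially. of_nat (hilbert_function n I k) = poly h (of_nat k))))"

text \<open>Addition and \<open>\<Sum>\<close> are the elementwise sums of sets.\<close>

definition integration_ideal :: "nat \<Rightarrow> nat \<Rightarrow> 'k::field weyl set \<Rightarrow> 'k weyl set" where
  "integration_ideal n m I =
     (I + (\<Sum>i=1..m. (\<lambda>P. \<partial> i * P) ` weyl_algebra {1..n})) \<inter> weyl_algebra {m+1..n}"

text \<open>
  Programs work on binary trees whose leaves may carry field elements. They use the field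
  operations and the test for zero, treat field elements as indivisible, and contain no field
  constants other than those obtained from \<open>1\<close>. Control structures are sequencing, branching and
  unbounded loops; the empty tree \<open>Leaf\<close> is the truth value false and any other tree is true.
  Over the rationals this is Turing computability, with the usual coding of rational numbers; over
  the complex numbers it is computability by Blum-Shub-Smale machines without parameters and
  with equality tests.
\<close>

datatype 'k tree = Leaf | Scalar 'k | Node "'k tree" "'k tree"

datatype prog =
    PSkip
  | PLeaf
  | POne
  | PNode prog prog
  | PLeft
  | PRight
  | PAdd
  | PSub
  | PMult
  | PDiv
  | PIsZero
  | PSeq prog prog
  | PIf prog prog prog
  | PWhile prog prog

inductive computes :: "prog \<Rightarrow> 'k::field tree \<Rightarrow> 'k tree \<Rightarrow> bool" where
  "computes PSkip v v"
| "computes PLeaf v Leaf"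
| "computes POne v (Scalar 1)"
| "computes A v a \<Longrightarrow> computes B v b \<Longrightarrow> computes (PNode A B) v (Node a b)"
| "computes PLeft (Node a b) a"
| "computes PRight (Node a b) b"
| "computes PAdd (Node (Scalar s) (Scalar t)) (Scalar (s + t))"
| "computes PSub (Node (Scalar s) (Scalar t)) (Scalar (s - t))"
| "computes PMult (Node (Scalar s) (Scalar t)) (Scalar (s * t))"
| "t \<noteq> 0 \<Longrightarrow> computes PDiv (Node (Scalar s) (Scalar t)) (Scalar (s / t))"
| "computes PIsZero (Scalar s) (if s = 0 then Node Leaf Leaf else Leaf)"
| "computes A v u \<Longrightarrow> computes B u w \<Longrightarrow> computes (PSeq A B) v w"
| "computes C v c \<Longrightarrow> c \<noteq> Leaf \<Longrightarrow> computes A v w \<Longrightarrow> computes (PIf C A B) v w"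
| "computes C v Leaf \<Longrightarrow> computes B v w \<Longrightarrow> computes (PIf C A B) v w"
| "computes C v Leaf \<Longrightarrow> computes (PWhile C A) v v"
| "computes C v c \<Longrightarrow> c \<noteq> Leaf \<Longrightarrow> computes A v u \<Longrightarrow> computes (PWhile C A) u w \<Longrightarrow>
     computes (PWhile C A) v w"

lemma computes_deterministic: "computes A v w \<Longrightarrow> computes A v w' \<Longrightarrow> w' = w"
proof (induction arbitrary: w' rule: computes.induct)
  case (4 A v a B b)
  from 4(5) show ?case by (rule computes.cases) (use 4(3,4) in blast)+
next
  case (12 A v u B w)
  from 12(5) show ?case by (rule computes.cases) (use 12(3,4) in blast)+
next
  case (13 C v c A w B)
  from 13(6) show ?case by (rule computes.cases) (use 13(2,4,5) in blast)+
next
  case (14 C v B w A)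
  from 14(5) show ?case by (rule computes.cases) (use 14(3,4) in blast)+
next
  case (15 C v A)
  from 15(3) show ?case by (rule computes.cases) (use 15(2) in blast)+
next
  case (16 C v c A u w)
  from 16(8) show ?case by (rule computes.cases) (use 16(2,5-7) in blast)+
qed (erule computes.cases; simp; fail)+

text \<open>
  An operator is given to a program as a list of terms \<open>(c, \<alpha>, \<beta>)\<close>, which stands for the sum
  of the \<open>c x\<^sup>\<alpha> \<partial>\<^sup>\<beta>\<close>. The list need not be reduced, so an operator has many
  representations.
\<close>

type_synonym 'k terms = "('k \<times> nat list \<times> nat list) list"

definition represents :: "nat \<Rightarrow> 'k::field terms \<Rightarrow> 'k weyl \<Rightarrow> bool" where
  "represents n ts P \<longleftrightarrow>
     (\<forall>(c, \<alpha>, \<beta>) \<in> set ts. length \<alpha> = n \<and> length \<beta> = n) \<and>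
     P = (\<Sum>(c, \<alpha>, \<beta>)\<leftarrow>ts. weyl_scale c (weyl_monomial \<alpha> \<beta>))"

primrec tree_of_list :: "('a \<Rightarrow> 'k tree) \<Rightarrow> 'a list \<Rightarrow> 'k tree" where
  "tree_of_list e [] = Leaf"
| "tree_of_list e (y # ys) = Node (e y) (tree_of_list e ys)"

primrec tree_of_nat :: "nat \<Rightarrow> 'k tree" where
  "tree_of_nat 0 = Leaf"
| "tree_of_nat (Suc k) = Node Leaf (tree_of_nat k)"

definition tree_of_terms :: "'k terms \<Rightarrow> 'k tree" where
  "tree_of_terms = tree_of_list (\<lambda>(c, \<alpha>, \<beta>).
     Node (Scalar c) (Node (tree_of_list tree_of_nat \<alpha>) (tree_of_list tree_of_nat \<beta>)))"

definition tree_of_input :: "nat \<Rightarrow> nat \<Rightarrow> 'k terms list \<Rightarrow> 'k terms \<Rightarrow> 'k tree" where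
  "tree_of_input n m gs ps =
     Node (tree_of_nat n) (Node (tree_of_nat m)
       (Node (tree_of_list tree_of_terms gs) (tree_of_terms ps)))"

end

theory Submission
  imports Defs
begin

text \<open>
  If \<open>p\<close> lies in \<open>J\<close>, then \<open>p\<close> is a linear combination of finitely many operators \<open>u g\<close>, where \<open>g\<close> is
  a generator of \<open>I\<close>, and \<open>\<partial>\<^sub>i u\<close>, where \<open>i \<le> m\<close> and \<open>u\<close> is in both cases a word in the \<open>x\<^sub>j\<close> and \<open>\<partial>\<^sub>j\<close>. For
  \<open>k = 0, 1, \<dots>\<close> the algorithm expands these operators for the words of length at most \<open>k\<close> in normally
  ordered monomials and reduces \<open>p\<close> modulo them by Gaussian elimination. Each operator carries along
  the operators under \<open>\<partial>\<^sub>1, \<dots>, \<partial>\<^sub>m\<close> that it uses. When the remainder of \<open>p\<close> is \<open>0\<close>, these are the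
  inhomogeneous parts up to sign, and this happens for some \<open>k\<close>.
\<close>

section \<open>Computable functions on encoded data\<close>

text \<open>\<open>I\<close> is a left ideal and each \<open>\<partial>\<^sub>i D\<close> a right
  ideal, so their sum is in general only a vector space over \<open>K\<close>, and division with
  remainder over \<open>D\<close> is not at hand. Hence the linear algebra over \<open>K\<close> in
  finite-dimensional subspaces that exhaust the sum; no bound on \<open>k\<close> is computed, and
  membership of \<open>p\<close> in \<open>J\<close> is what makes the search stop. The test for
  remainder \<open>0\<close> must cope with the many term lists of one operator. It rests on linear
  independence of the normally ordered monomials, obtained from an action in which a single function
  detects every coefficient. Programs are not written out: computable functions are closed under the
  usual constructions on lists and numbers, so each program follows the shape of a HOL definition.
  The field is arbitrary, so both choices of \<open>K\<close> are instances of one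
  statement.\<close>

definition enc_prod :: "('a \<Rightarrow> 'k tree) \<Rightarrow> ('b \<Rightarrow> 'k tree) \<Rightarrow> 'a \<times> 'b \<Rightarrow> 'k tree" where
  "enc_prod ea eb p = Node (ea (fst p)) (eb (snd p))"

definition enc_unit :: "unit \<Rightarrow> 'k tree" where
  "enc_unit u = Leaf"

definition enc_bool :: "bool \<Rightarrow> 'k tree" where
  "enc_bool b = (if b then Node Leaf Leaf else Leaf)"

text \<open>The rules below are closure properties for functions of one common argument
  \<open>a\<close>, the environment of a term; a program for a composite term is assembled along its
  structure.\<close>

definition computable :: "('a \<Rightarrow> 'k::field tree) \<Rightarrow> ('b \<Rightarrow> 'k tree) \<Rightarrow> ('a \<Rightarrow> 'b) \<Rightarrow> bool" where
  "computable ea eb f \<longleftrightarrow> (\<exists>A. \<forall>x. computes A (ea x) (eb (f x)))"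

named_theorems comp_rules

lemma computableI: "(\<And>x. computes A (ea x) (eb (f x))) \<Longrightarrow> computable ea eb f"
  by (auto simp: computable_def)

text \<open>The program stays the same and only the reading of its output changes: for example, a
  nonempty list has the tree of the pair of its head and tail.\<close>

lemma computable_cong_enc: "computable ea eb f \<Longrightarrow> (\<And>x. ec (g x) = eb (f x)) \<Longrightarrow> computable ea ec g"
  by (auto simp: computable_def)

lemma computable_id [comp_rules]: "computable e e (\<lambda>a. a)"
  by (rule computableI) (rule computes.intros)

lemma computable_comp:
  assumes "computable eb ec f" "computable ea eb h"
  shows "computable ea ec (\<lambda>a. f (h a))"
proof -
  from assms obtain A B where "\<And>x. computes A (eb x) (ec (f x))" "\<And>x. computes B (ea x) (eb (h x))"
    by (auto simp: computable_def)
  then have "computes (PSeq B A) (ea x) (ec (f (h x)))" for x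
    by (blast intro: computes.intros)
  then show ?thesis by (rule computableI)
qed

lemma computable_Pair [comp_rules]:
  assumes "computable ea eb f" "computable ea ec g"
  shows "computable ea (enc_prod eb ec) (\<lambda>a. (f a, g a))"
proof -
  from assms obtain A B where "\<And>x. computes A (ea x) (eb (f x))" "\<And>x. computes B (ea x) (ec (g x))"
    by (auto simp: computable_def)
  then have "computes (PNode A B) (ea x) (enc_prod eb ec (f x, g x))" for x
    by (auto simp: enc_prod_def intro: computes.intros)
  then show ?thesis by (rule computableI)
qed

lemma computable_fst [comp_rules]:
  "computable ea (enc_prod eb ec) f \<Longrightarrow> computable ea eb (\<lambda>a. fst (f a))"
  by (rule computable_comp[of "enc_prod eb ec"], rule computableI[of PLeft])
    (simp_all add: enc_prod_def computes.intros)

lemma computable_snd [comp_rules]: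
  "computable ea (enc_prod eb ec) f \<Longrightarrow> computable ea ec (\<lambda>a. snd (f a))"
  by (rule computable_comp[of "enc_prod eb ec"], rule computableI[of PRight])
    (simp_all add: enc_prod_def computes.intros)

lemma computable_comp2:
  assumes "computable (enc_prod eb ec) ed (\<lambda>p. h (fst p) (snd p))"
    and "computable ea eb f" "computable ea ec g"
  shows "computable ea ed (\<lambda>a. h (f a) (g a))"
  using computable_comp[OF assms(1) computable_Pair[OF assms(2,3)]] by simp

lemma computable_True [comp_rules]: "computable ea enc_bool (\<lambda>_. True)"
  by (rule computableI[of "PNode PLeaf PLeaf"]) (simp add: enc_bool_def computes.intros)

lemma computable_False [comp_rules]: "computable ea enc_bool (\<lambda>_. False)"
  by (rule computableI[of PLeaf]) (simp add: enc_bool_def computes.intros)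

lemma computable_If [comp_rules]:
  assumes "computable ea enc_bool b" "computable ea eb f" "computable ea eb g"
  shows "computable ea eb (\<lambda>a. if b a then f a else g a)"
proof -
  from assms obtain C A B where *: "\<And>x. computes C (ea x) (enc_bool (b x))"
    "\<And>x. computes A (ea x) (eb (f x))" "\<And>x. computes B (ea x) (eb (g x))"
    by (auto simp: computable_def)
  have "computes (PIf C A B) (ea x) (eb (if b x then f x else g x))" for x
    using *[of x] by (cases "b x") (auto simp: enc_bool_def intro: computes.intros)
  then show ?thesis by (rule computableI)
qed

lemma computable_Not [comp_rules]:
  "computable ea enc_bool b \<Longrightarrow> computable ea enc_bool (\<lambda>a. \<not> b a)"
  by (drule computable_If[OF _ computable_False computable_True], erule computable_cong_enc) auto

lemma computable_conj [comp_rules]: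
  "computable ea enc_bool b \<Longrightarrow> computable ea enc_bool c \<Longrightarrow> computable ea enc_bool (\<lambda>a. b a \<and> c a)"
  by (drule (1) computable_If[OF _ _ computable_False], erule computable_cong_enc) auto

section \<open>Lists\<close>

lemma computable_Nil [comp_rules]: "computable ea (tree_of_list e) (\<lambda>_. [])"
  by (rule computableI[of PLeaf]) (simp add: computes.intros)

lemma computable_Cons [comp_rules]:
  assumes "computable ea e f" "computable ea (tree_of_list e) g"
  shows "computable ea (tree_of_list e) (\<lambda>a. f a # g a)"
  using computable_Pair[OF assms] by (rule computable_cong_enc) (simp add: enc_prod_def)

text \<open>The empty list is encoded by \<open>Leaf\<close>, which counts as false, and every other
  list by a \<open>Node\<close>; so the encoded list is its own test.\<close>

lemma computable_case_list [comp_rules]: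
  assumes "computable ea (tree_of_list e) xs" "computable ea eb f"
    and "computable (enc_prod ea (enc_prod e (tree_of_list e))) eb
      (\<lambda>p. g (fst p) (fst (snd p)) (snd (snd p)))"
  shows "computable ea eb (\<lambda>a. case xs a of [] \<Rightarrow> f a | y # ys \<Rightarrow> g a y ys)"
proof -
  from assms(1,2) obtain X F where X: "\<And>x. computes X (ea x) (tree_of_list e (xs x))"
    and F: "\<And>x. computes F (ea x) (eb (f x))"
    by (auto simp: computable_def)
  from assms(3) obtain G where G: "\<And>p. computes G (enc_prod ea (enc_prod e (tree_of_list e)) p)
      (eb (g (fst p) (fst (snd p)) (snd (snd p))))"
    unfolding computable_def by blast
  have "computes (PIf X (PSeq (PNode PSkip X) G) F) (ea a)
    (eb (case xs a of [] \<Rightarrow> f a | y # ys \<Rightarrow> g a y ys))" for a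
  proof (cases "xs a")
    case Nil
    then show ?thesis using X[of a] F[of a] by (auto intro: computes.intros)
  next
    case (Cons y ys)
    have "computes (PSeq (PNode PSkip X) G) (ea a) (eb (g a y ys))"
      using X[of a] G[of "(a, y, ys)"] Cons by (auto simp: enc_prod_def intro: computes.intros)
    then show ?thesis using X[of a] Cons by (auto intro: computes.intros)
  qed
  then show ?thesis by (rule computableI)
qed

text \<open>All bounded recursion, on lists and on unary numbers, is reduced to this one
  loop.\<close>

lemma computable_foldl [comp_rules]:
  assumes "computable ea (tree_of_list ex) xs" "computable ea es s"
    and "computable (enc_prod ea (enc_prod es ex)) es (\<lambda>p. f (fst p) (fst (snd p)) (snd (snd p)))"
  shows "computable ea es (\<lambda>a. foldl (\<lambda>s x. f a s x) (s a) (xs a))"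
proof -
  from assms(1,2) obtain X S where X: "\<And>x. computes X (ea x) (tree_of_list ex (xs x))"
    and S: "\<And>x. computes S (ea x) (es (s x))"
    by (auto simp: computable_def)
  from assms(3) obtain F where F: "\<And>p. computes F (enc_prod ea (enc_prod es ex) p)
      (es (f (fst p) (fst (snd p)) (snd (snd p))))"
    unfolding computable_def by blast
  \<comment> \<open>The loop state consists of the unread list, the accumulator and the argument
    \<open>a\<close>, which \<open>f\<close> may use in every round. The unread list is also the
    loop test.\<close>
  let ?a = "PSeq PRight PRight" and ?s = "PSeq PRight PLeft"
  let ?B = "PNode (PSeq PLeft PRight)
     (PNode (PSeq (PNode ?a (PNode ?s (PSeq PLeft PLeft))) F) ?a)"
  have B: "computes ?B (Node (Node (ex x) t) (Node (es u) (ea a)))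
      (Node t (Node (es (f a u x)) (ea a)))" for x t u a
    by (rule computes.intros(4,5,6,12) F[of "(a, u, x)", unfolded enc_prod_def fst_conv snd_conv])+
  have W: "computes (PWhile PLeft ?B) (Node (tree_of_list ex l) (Node (es u) (ea a)))
      (Node Leaf (Node (es (foldl (f a) u l)) (ea a)))" for l u a
  proof (induction l arbitrary: u)
    case Nil
    show ?case by (auto intro!: computes.intros)
  next
    case (Cons x l)
    have "computes (PWhile PLeft ?B) (Node (tree_of_list ex (x # l)) (Node (es u) (ea a)))
      (Node Leaf (Node (es (foldl (f a) (f a u x) l)) (ea a)))"
      unfolding tree_of_list.simps
      by (rule computes.intros(16)[OF _ _ B Cons]) (rule computes.intros, simp)
    then show ?case by simp
  qed
  have "computes (PNode X (PNode S PSkip)) (ea a)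
      (Node (tree_of_list ex (xs a)) (Node (es (s a)) (ea a)))" for a
    by (intro computes.intros X S)
  moreover have "computes (PSeq PRight PLeft) (Node Leaf (Node t u)) t" for t u
    by (rule computes.intros(5,6,12))+
  ultimately have "computes (PSeq (PNode X (PNode S PSkip)) (PSeq (PWhile PLeft ?B) ?s)) (ea a)
      (es (foldl (f a) (s a) (xs a)))" for a
    using W by (meson computes.intros(12))
  then show ?thesis by (rule computableI)
qed

lemma computable_rev [comp_rules]:
  assumes "computable ea (tree_of_list e) xs"
  shows "computable ea (tree_of_list e) (\<lambda>a. rev (xs a))"
proof -
  have rev_eq: "rev l = foldl (\<lambda>s x. x # s) [] l" for l :: "'c list"
    by (simp add: foldl_conv_fold rev_conv_fold)
  show ?thesis
    unfolding rev_eq by (rule comp_rules assms)+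
qed

lemma computable_foldr [comp_rules]:
  assumes "computable ea (tree_of_list ex) xs" "computable ea es s"
    and "computable (enc_prod ea (enc_prod es ex)) es (\<lambda>p. f (fst p) (snd (snd p)) (fst (snd p)))"
  shows "computable ea es (\<lambda>a. foldr (\<lambda>x s. f a x s) (xs a) (s a))"
  unfolding foldr_conv_foldl by (rule comp_rules assms)+

lemma computable_map [comp_rules]:
  assumes "computable ea (tree_of_list ex) xs"
    and "computable (enc_prod ea ex) ey (\<lambda>p. f (fst p) (snd p))"
  shows "computable ea (tree_of_list ey) (\<lambda>a. map (\<lambda>x. f a x) (xs a))"
proof -
  have map_eq: "map g l = foldr (\<lambda>x s. g x # s) l []" for g :: "'c \<Rightarrow> 'd" and l
    by (induction l) auto
  have "computable (enc_prod ea (enc_prod es ex)) ey (\<lambda>p. f (fst p) (snd (snd p)))" for es :: "'d list \<Rightarrow> _"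
    by (rule computable_comp2[OF assms(2)]; (rule comp_rules)+)
  then show ?thesis
    unfolding map_eq by - (rule comp_rules assms | assumption)+
qed

lemma computable_append [comp_rules]:
  assumes "computable ea (tree_of_list e) xs" "computable ea (tree_of_list e) ys"
  shows "computable ea (tree_of_list e) (\<lambda>a. xs a @ ys a)"
proof -
  have append_eq: "l @ l' = foldr (\<lambda>x s. x # s) l l'" for l l' :: "'c list"
    by (induction l) auto
  show ?thesis unfolding append_eq by (rule comp_rules assms)+
qed

lemma computable_concat [comp_rules]:
  assumes "computable ea (tree_of_list (tree_of_list e)) xs"
  shows "computable ea (tree_of_list e) (\<lambda>a. concat (xs a))"
  unfolding concat_conv_foldr by (rule comp_rules assms)+

lemma computable_filter [comp_rules]:
  assumes "computable ea (tree_of_list e) xs"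
    and "computable (enc_prod ea e) enc_bool (\<lambda>p. P (fst p) (snd p))"
  shows "computable ea (tree_of_list e) (\<lambda>a. filter (\<lambda>x. P a x) (xs a))"
proof -
  have filter_eq: "filter Q l = concat (map (\<lambda>x. if Q x then [x] else []) l)" for Q and l :: "'c list"
    by (induction l) auto
  show ?thesis unfolding filter_eq by (rule comp_rules assms)+
qed

lemma computable_Nil_test [comp_rules]:
  assumes "computable ea (tree_of_list e) xs"
  shows "computable ea enc_bool (\<lambda>a. xs a = [])"
proof -
  have Nil_eq: "l = [] \<longleftrightarrow> (case l of [] \<Rightarrow> True | _ # _ \<Rightarrow> False)" for l :: "'c list"
    by (cases l) auto
  show ?thesis unfolding Nil_eq[of "xs _"] by (rule comp_rules assms)+
qed

lemma computable_tl [comp_rules]: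
  assumes "computable ea (tree_of_list e) xs"
  shows "computable ea (tree_of_list e) (\<lambda>a. tl (xs a))"
proof -
  have tl_eq: "tl l = (case l of [] \<Rightarrow> [] | _ # ys \<Rightarrow> ys)" for l :: "'c list"
    by (cases l) auto
  show ?thesis unfolding tl_eq by (rule comp_rules assms)+
qed

section \<open>Natural numbers and positions in lists\<close>

lemma tree_of_nat_conv_list: "tree_of_nat n = tree_of_list enc_unit (replicate n ())"
  by (induction n) (auto simp: enc_unit_def)

lemma computable_0 [comp_rules]: "computable ea tree_of_nat (\<lambda>_. 0)"
  by (rule computableI[of PLeaf]) (simp add: computes.intros)

lemma computable_Suc [comp_rules]:
  assumes "computable ea tree_of_nat f"
  shows "computable ea tree_of_nat (\<lambda>a. Suc (f a))"
proof -
  have "computable ea enc_unit (\<lambda>_. ())"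
    by (rule computableI[of PLeaf]) (simp add: enc_unit_def computes.intros)
  from computable_Pair[OF this assms] show ?thesis
    by (rule computable_cong_enc) (simp add: enc_prod_def enc_unit_def)
qed

lemma computable_replicate_unit:
  "computable ea tree_of_nat f \<Longrightarrow> computable ea (tree_of_list enc_unit) (\<lambda>a. replicate (f a) ())"
  by (erule computable_cong_enc) (simp add: tree_of_nat_conv_list)

text \<open>A unary number is a list of trivial values, so iteration is a fold that ignores the
  entries.\<close>

lemma computable_funpow [comp_rules]:
  assumes "computable ea tree_of_nat k" "computable ea es s"
    and "computable (enc_prod ea es) es (\<lambda>p. f (fst p) (snd p))"
  shows "computable ea es (\<lambda>a. ((\<lambda>s. f a s) ^^ k a) (s a))"
proof -
  have funpow_eq: "(g ^^ j) u = foldl (\<lambda>s _. g s) u (replicate j ())" for g j u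
    by (induction j arbitrary: u) (simp_all add: funpow_Suc_right del: funpow.simps(2))
  have "computable (enc_prod ea (enc_prod es enc_unit)) es (\<lambda>p. f (fst p) (fst (snd p)))"
    by (rule computable_comp2[OF assms(3)]; (rule comp_rules)+)
  then show ?thesis
    unfolding funpow_eq by - (rule computable_foldl computable_replicate_unit assms | assumption)+
qed

lemma computable_drop [comp_rules]:
  assumes "computable ea tree_of_nat k" "computable ea (tree_of_list e) xs"
  shows "computable ea (tree_of_list e) (\<lambda>a. drop (k a) (xs a))"
proof -
  have drop_eq: "drop j l = (tl ^^ j) l" for j and l :: "'c list"
    by (induction j arbitrary: l) (auto simp: drop_Suc funpow_swap1 tl_drop)
  show ?thesis unfolding drop_eq by (rule comp_rules assms)+
qed

text \<open>This replaces \<open>!\<close>, whose value out of range is unspecified, whereas a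
  program has to produce the value for every argument.\<close>

lemma computable_nth_default [comp_rules]:
  assumes "computable ea (tree_of_list e) xs" "computable ea tree_of_nat k" "computable ea e d"
  shows "computable ea e (\<lambda>a. nth_default (d a) (xs a) (k a))"
proof -
  have nth_default_eq: "nth_default u l j = (case drop j l of [] \<Rightarrow> u | y # _ \<Rightarrow> y)" for u :: 'c and l j
    by (cases "j < length l") (simp_all add: nth_default_def Cons_nth_drop_Suc[of j l, symmetric] del: Cons_nth_drop_Suc)
  show ?thesis unfolding nth_default_eq by (rule comp_rules assms)+
qed

lemma computable_length [comp_rules]:
  assumes "computable ea (tree_of_list e) xs"
  shows "computable ea tree_of_nat (\<lambda>a. length (xs a))"
proof -
  have length_eq: "length l = foldr (\<lambda>_ s. Suc s) l 0" for l :: "'c list"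
    by (induction l) auto
  show ?thesis unfolding length_eq by (rule comp_rules assms)+
qed

lemma computable_upt [comp_rules]:
  assumes "computable ea tree_of_nat k"
  shows "computable ea (tree_of_list tree_of_nat) (\<lambda>a. [0..<k a])"
proof -
  have upt_eq: "((\<lambda>l. l @ [length l]) ^^ j) [] = [0..<j]" for j
    by (induction j) auto
  show ?thesis unfolding upt_eq[symmetric] by (rule comp_rules assms)+
qed

lemma computable_list_eq:
  fixes xs :: "'a \<Rightarrow> 'b list"
  assumes "computable (enc_prod e e) enc_bool (\<lambda>p. fst p = snd p)"
    and "computable ea (tree_of_list e) xs" "computable ea (tree_of_list e) ys"
  shows "computable ea enc_bool (\<lambda>a. xs a = ys a)"
proof -
  \<comment> \<open>A fold walks along one list only, so the state carries the unread part of the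
    second list, next to a flag that never returns to true.\<close>
  define cmp where "cmp = (\<lambda>s (x::'b). case snd s of [] \<Rightarrow> (False, [])
    | y # ys \<Rightarrow> if x = y then (fst s, ys) else (False, ys))"
  have F: "\<not> fst (foldl cmp (False, l') l)"  for l l' :: "'b list"
    by (induction l arbitrary: l') (auto simp: cmp_def split: list.split)
  have eq: "l = l' \<longleftrightarrow> fst (foldl cmp (True, l') l) \<and> snd (foldl cmp (True, l') l) = []"   for l l' :: "'b list"
  proof (induction l arbitrary: l')
    case (Cons x l)
    then show ?case using F by (cases l') (auto simp: cmp_def)
  qed auto
  show ?thesis
    unfolding eq[of "xs _" "ys _"] unfolding cmp_def
    by (rule comp_rules assms(2,3) assms(1)[THEN computable_comp2[where h = "(=)"]])+
qed


lemma computable_nat_eq [comp_rules]: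
  assumes "computable ea tree_of_nat f" "computable ea tree_of_nat g"
  shows "computable ea enc_bool (\<lambda>a. f a = g a)"
proof -
  have nat_eq: "i = j \<longleftrightarrow> replicate i () = replicate j ()" for i j
    by (metis length_replicate)
  have "computable (enc_prod enc_unit enc_unit) enc_bool (\<lambda>p. fst p = snd p)"
    by (simp add: computable_True)
  then show ?thesis
    unfolding nat_eq[of "f _"]
    by - (rule computable_list_eq computable_replicate_unit assms | assumption)+
qed

lemma computable_nat_list_eq [comp_rules]:
  assumes "computable ea (tree_of_list tree_of_nat) f" "computable ea (tree_of_list tree_of_nat) g"
  shows "computable ea enc_bool (\<lambda>a. f a = g a)"
  by (rule computable_list_eq[OF _ assms]) (rule comp_rules)+

lemma computable_list_update [comp_rules]:
  assumes "computable ea (tree_of_list e) xs" "computable ea tree_of_nat k" "computable ea e u"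
  shows "computable ea (tree_of_list e) (\<lambda>a. (xs a)[k a := u a])"
proof -
  have update_eq: "l[j := v] = map (\<lambda>i. if i = j then v else nth_default v l i) [0..<length l]" for l j v
    by (rule nth_equalityI) (auto simp: nth_default_def nth_list_update)
  \<comment> \<open>Under the binder of \<open>map\<close> the environment is the pair of
    \<open>a\<close> and the index, so there the assumptions are composed with the projection to
    \<open>a\<close>.\<close>
  show ?thesis
    unfolding update_eq
    by (rule comp_rules assms assms[THEN computable_comp])+
qed

section \<open>Field elements\<close>

lemma computable_1_scalar [comp_rules]: "computable ea Scalar (\<lambda>_. 1)"
  by (rule computableI) (rule computes.intros)

lemma computable_minus [comp_rules]:
  assumes "computable ea Scalar f" "computable ea Scalar g"
  shows "computable ea Scalar (\<lambda>a. f a - g a)"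
  by (rule computable_comp2[OF _ assms, where h = "(-)"], rule computableI[of PSub])
    (simp add: enc_prod_def computes.intros)

text \<open>The only field constant of programs is 1, so 0 is obtained as
  \<open>1 - 1\<close>.\<close>

lemma computable_0_scalar [comp_rules]: "computable ea Scalar (\<lambda>_. 0)"
  using computable_minus[OF computable_1_scalar computable_1_scalar] by simp

lemma computable_uminus [comp_rules]:
  "computable ea Scalar f \<Longrightarrow> computable ea Scalar (\<lambda>a. - f a)"
  using computable_minus[OF computable_0_scalar] by force

lemma computable_plus [comp_rules]:
  assumes "computable ea Scalar f" "computable ea Scalar g"
  shows "computable ea Scalar (\<lambda>a. f a + g a)"
  by (rule computable_comp2[OF _ assms, where h = "(+)"], rule computableI[of PAdd])
    (simp add: enc_prod_def computes.intros)

lemma computable_times [comp_rules]: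
  assumes "computable ea Scalar f" "computable ea Scalar g"
  shows "computable ea Scalar (\<lambda>a. f a * g a)"
  by (rule computable_comp2[OF _ assms, where h = "(*)"], rule computableI[of PMult])
    (simp add: enc_prod_def computes.intros)

lemma computable_zero_test [comp_rules]:
  "computable ea Scalar f \<Longrightarrow> computable ea enc_bool (\<lambda>a. f a = 0)"
  by (rule computable_comp[of Scalar], rule computableI[of PIsZero])
    (simp_all add: enc_bool_def computes.intros)

text \<open>Division by \<open>0\<close> gives \<open>0\<close> in HOL, while \<^const>\<open>PDiv\<close> has no result.\<close>

lemma computable_divide [comp_rules]:
  assumes "computable ea Scalar f" "computable ea Scalar g"
  shows "computable ea Scalar (\<lambda>a. f a / g a)"
proof (rule computable_comp2[OF _ assms, where h = "(/)"], rule computableI)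
  fix p :: "'b \<times> 'b"
  obtain s t where p: "p = (s, t)" by force
  have test: "computes (PSeq PRight PIsZero) (Node (Scalar s) (Scalar t)) (if t = 0 then Node Leaf Leaf else Leaf)"
    by (rule computes.intros(6,11,12))+
  show "computes (PIf (PSeq PRight PIsZero) PRight PDiv) (enc_prod Scalar Scalar p) (Scalar (fst p / snd p))"
    using test computes.intros(6)[of "Scalar s" "Scalar t"] computes.intros(10)[of t s]
    by (cases "t = 0") (auto simp: p enc_prod_def intro: computes.intros(13,14))
qed

lemma computable_of_nat [comp_rules]:
  assumes "computable ea tree_of_nat f"
  shows "computable ea Scalar (\<lambda>a. of_nat (f a))"
proof -
  have of_nat_eq: "of_nat j = ((\<lambda>s. s + 1) ^^ j) 0" for j
    by (induction j) (auto simp: algebra_simps)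
  show ?thesis
    unfolding of_nat_eq by (rule comp_rules assms)+
qed

text \<open>This is the only loop without a bound known in advance; therefore the program is claimed
  to halt only on inputs that have a witness.\<close>

lemma computable_search:
  assumes "computable (enc_prod tree_of_nat e) enc_bool (\<lambda>p. P (snd p) (fst p))"
    and "computable (enc_prod tree_of_nat e) eb (\<lambda>p. f (snd p) (fst p))"
  obtains A where "\<And>x. \<exists>k. P x k \<Longrightarrow> \<exists>k. P x k \<and> computes A (e x) (eb (f x k))"
proof -
  obtain C where C: "\<And>k x. computes C (Node (tree_of_nat k) (e x)) (enc_bool (\<not> P x k))"
    using computable_Not[OF assms(1)] unfolding computable_def enc_prod_def by auto
  obtain F where F: "\<And>k x. computes F (Node (tree_of_nat k) (e x)) (eb (f x k))"
    using assms(2) unfolding computable_def enc_prod_def by auto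
  obtain S where S: "\<And>k x. computes S (Node (tree_of_nat k) (e x)) (Node (tree_of_nat (Suc k)) (e x))"
  proof -
    have "computable (enc_prod tree_of_nat e) (enc_prod tree_of_nat e) (\<lambda>p. (Suc (fst p), snd p))"
      by (rule comp_rules)+
    then show ?thesis using that unfolding computable_def enc_prod_def by auto
  qed
  \<comment> \<open>Induction downward from a known witness \<open>j\<close>: the loop stops at
    \<open>j\<close> at the latest.\<close>
  have W: "\<exists>k. P x k \<and> computes (PWhile C S) (Node (tree_of_nat i) (e x)) (Node (tree_of_nat k) (e x))"
    if "P x j" "i \<le> j" for x i j
    using that(2)
  proof (induction i rule: inc_induct)
    case base
    then show ?case using that(1) C[of j x]
      by (auto simp: enc_bool_def intro!: exI[of _ j] computes.intros(15))
  next
    case (step i)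
    show ?case
    proof (cases "P x i")
      case True
      then show ?thesis using C[of i x]
        by (auto simp: enc_bool_def intro!: exI[of _ i] computes.intros(15))
    next
      case False
      then show ?thesis
        using step C[of i x] S[of i x] computes.intros(16)[OF C[of i x]] by (auto simp: enc_bool_def)
    qed
  qed
  show ?thesis
  proof (rule that)
    fix x assume "\<exists>k. P x k"
    then obtain j where "P x j" ..
    from W[OF this, of 0] obtain k where k: "P x k"
        "computes (PWhile C S) (Node Leaf (e x)) (Node (tree_of_nat k) (e x))" by auto
    have "computes (PNode PLeaf PSkip) (e x) (Node Leaf (e x))"
      by (intro computes.intros)
    with k(2) F[of k x] have "computes (PSeq (PNode PLeaf PSkip) (PSeq (PWhile C S) F)) (e x) (eb (f x k))"
      by (meson computes.intros(12))
    with k(1) show "\<exists>k. P x k \<and> computes (PSeq (PNode PLeaf PSkip) (PSeq (PWhile C S) F)) (e x) (eb (f x k))"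
      by blast
  qed
qed

section \<open>Normal order in the Weyl algebra\<close>

text \<open>
  \<open>D\<close> acts on functions of \<open>(x, \<xi>)\<close>, with \<open>\<partial>\<^sub>i\<close> acting as \<open>\<partial>/\<partial>x\<^sub>i + \<xi>\<^sub>i\<close>. The monomial \<open>x\<^sup>\<alpha> \<partial>\<^sup>\<beta>\<close> sends \<open>1\<close> to
  \<open>x\<^sup>\<alpha> \<xi>\<^sup>\<beta>\<close>, hence the coefficients of an operator in normal order do not depend on how it is
  written.
\<close>

primrec symbol_act :: "'k::field wexpr \<Rightarrow> ((nat \<Rightarrow> nat) \<Rightarrow> (nat \<Rightarrow> nat) \<Rightarrow> 'k) \<Rightarrow> (nat \<Rightarrow> nat) \<Rightarrow> (nat \<Rightarrow> nat) \<Rightarrow> 'k" where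
  "symbol_act (WConst s) f = (\<lambda>a b. s * f a b)"
| "symbol_act (WX i) f = (\<lambda>a b. if a i = 0 then 0 else f (a(i := a i - 1)) b)"
| "symbol_act (WD i) f = (\<lambda>a b. of_nat (a i + 1) * f (a(i := a i + 1)) b +
     (if b i = 0 then 0 else f a (b(i := b i - 1))))"
| "symbol_act (WPlus P Q) f = (\<lambda>a b. symbol_act P f a b + symbol_act Q f a b)"
| "symbol_act (WTimes P Q) f = symbol_act P (symbol_act Q f)"

lemma symbol_act_add:
  "symbol_act P (\<lambda>a b. f a b + g a b) = (\<lambda>a b. symbol_act P f a b + symbol_act P g a b)"
proof (induction P arbitrary: f g)
  case (WTimes P Q)
  then show ?case by simp
qed (auto simp: fun_eq_iff algebra_simps)

lemma symbol_act_scale: "symbol_act P (\<lambda>a b. s * f a b) = (\<lambda>a b. s * symbol_act P f a b)"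
proof (induction P arbitrary: f)
  case (WTimes P Q)
  then show ?case by simp
qed (auto simp: fun_eq_iff algebra_simps)

lemma symbol_act_weq: "weq P Q \<Longrightarrow> symbol_act P = symbol_act Q"
proof (induction rule: weq.induct)
  case (cong_times a a' b b')
  then show ?case by (metis (no_types, lifting) ext symbol_act.simps(5))
next
  case (x_comm i j)
  then show ?case by (cases "i = j") (auto simp: fun_eq_iff fun_upd_twist)
next
  case (d_comm i j)
  then show ?case by (cases "i = j") (auto simp: fun_eq_iff fun_upd_twist algebra_simps)
next
  case (d_x i j)
  then show ?case by (cases "i = j") (auto simp: fun_eq_iff fun_upd_twist algebra_simps)
qed (auto simp: fun_eq_iff symbol_act_add symbol_act_scale algebra_simps)

lift_definition weyl_act :: "'k::field weyl \<Rightarrow> ((nat \<Rightarrow> nat) \<Rightarrow> (nat \<Rightarrow> nat) \<Rightarrow> 'k) \<Rightarrow>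
    (nat \<Rightarrow> nat) \<Rightarrow> (nat \<Rightarrow> nat) \<Rightarrow> 'k" is symbol_act
  by (rule symbol_act_weq)

lemma weyl_act_0: "weyl_act 0 f = (\<lambda>a b. 0)"
  by transfer simp

lemma weyl_act_add: "weyl_act (P + Q) f = (\<lambda>a b. weyl_act P f a b + weyl_act Q f a b)"
  by transfer simp

lemma weyl_act_mult: "weyl_act (P * Q) f = weyl_act P (weyl_act Q f)"
  by transfer simp

lemma weyl_act_1: "weyl_act 1 f = f"
  by transfer simp

lemma weyl_act_scale: "weyl_act (weyl_scale c P) f = (\<lambda>a b. c * weyl_act P f a b)"
  unfolding weyl_scale_def by transfer simp

definition delta :: "(nat \<Rightarrow> nat) \<Rightarrow> (nat \<Rightarrow> nat) \<Rightarrow> (nat \<Rightarrow> nat) \<Rightarrow> (nat \<Rightarrow> nat) \<Rightarrow> 'k::field" where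
  "delta a b = (\<lambda>a' b'. if a' = a \<and> b' = b then 1 else 0)"

lemma weyl_act_x: "weyl_act (weyl_x i) f = (\<lambda>a b. if a i = 0 then 0 else f (a(i := a i - 1)) b)"
  by transfer simp

lemma weyl_act_d: "weyl_act (\<partial> i) f = (\<lambda>a b. of_nat (a i + 1) * f (a(i := a i + 1)) b +
    (if b i = 0 then 0 else f a (b(i := b i - 1))))"
  by transfer simp

text \<open>The action looks up a coefficient at an exponent lowered by one, while
  \<open>delta\<close> moves its point up by one; this translates between the two.\<close>

lemma fun_upd_pred_iff:
  fixes a a' :: "nat \<Rightarrow> nat"
  shows "a' i \<noteq> 0 \<and> a'(i := a' i - 1) = a \<longleftrightarrow> a' = a(i := Suc (a i))"
  by (auto simp: fun_eq_iff)

lemma weyl_act_x_delta: "weyl_act (weyl_x i) (delta a b) = delta (a(i := Suc (a i))) b"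
  unfolding weyl_act_x delta_def by (intro ext) (simp flip: fun_upd_pred_iff)

text \<open>Since \<open>x\<^sub>i\<close> does not occur, the derivative vanishes and only
  multiplication by \<open>\<xi>\<^sub>i\<close> remains. This suffices for normally ordered
  monomials, whose \<open>\<partial>\<close> factors act first, on 1.\<close>

lemma weyl_act_d_delta:
  assumes "a i = 0"
  shows "weyl_act (\<partial> i) (delta a b) = delta a (b(i := Suc (b i)))"
proof -
  have "a'(i := Suc (a' i)) \<noteq> a" for a'
    using assms by (auto simp: fun_eq_iff)
  then show ?thesis
    unfolding weyl_act_d delta_def by (intro ext) (simp flip: fun_upd_pred_iff)
qed

lemma weyl_act_x_power_delta:
  "weyl_act (weyl_x i ^ k) (delta a b) = delta (a(i := a i + k)) b"
proof (induction k)
  case (Suc k)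
  then show ?case
    by (simp only: power_Suc weyl_act_mult weyl_act_x_delta fun_upd_same fun_upd_upd add_Suc_right)
qed (simp add: weyl_act_1)

lemma weyl_act_d_power_delta:
  "a i = 0 \<Longrightarrow> weyl_act (\<partial> i ^ k) (delta a b) = delta a (b(i := b i + k))"
proof (induction k)
  case (Suc k)
  then show ?case
    by (simp only: power_Suc weyl_act_mult weyl_act_d_delta fun_upd_same fun_upd_upd add_Suc_right)
qed (simp add: weyl_act_1)

text \<open>Variables are numbered from 1 and list positions from 0.\<close>

definition list_exponent :: "nat list \<Rightarrow> nat \<Rightarrow> nat" where
  "list_exponent \<alpha> v = (if 1 \<le> v \<and> v \<le> length \<alpha> then \<alpha> ! (v - 1) else 0)"

lemma list_exponent_inject:
  assumes "length \<alpha> = length \<alpha>'"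
  shows "list_exponent \<alpha> = list_exponent \<alpha>' \<longleftrightarrow> \<alpha> = \<alpha>'"
proof
  assume *: "list_exponent \<alpha> = list_exponent \<alpha>'"
  have "\<alpha> ! i = \<alpha>' ! i" if "i < length \<alpha>" for i
    using fun_cong[OF *, of "Suc i"] that assms by (simp add: list_exponent_def)
  then show "\<alpha> = \<alpha>'" using assms by (auto intro: nth_equalityI)
qed simp

lemma weyl_act_x_prod_delta:
  "weyl_act (\<Prod>i\<leftarrow>js. weyl_x (Suc i) ^ e i) (delta a b) =
     delta (\<lambda>v. a v + (\<Sum>i\<leftarrow>js. if v = Suc i then e i else 0)) b"
proof (induction js)
  case (Cons k js)
  show ?case
    unfolding list.map prod_list.Cons weyl_act_mult Cons weyl_act_x_power_delta
    by (rule arg_cong[of _ _ "\<lambda>a. delta a b"]) (auto simp: fun_eq_iff)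
qed (simp add: weyl_act_1)

lemma weyl_act_d_prod_delta:
  assumes "\<And>v. a v = 0"
  shows "weyl_act (\<Prod>i\<leftarrow>js. \<partial> (Suc i) ^ e i) (delta a b) =
     delta a (\<lambda>v. b v + (\<Sum>i\<leftarrow>js. if v = Suc i then e i else 0))"
proof (induction js)
  case (Cons k js)
  show ?case
    unfolding list.map prod_list.Cons weyl_act_mult Cons weyl_act_d_power_delta[where a = a and i = "Suc k", OF assms]
    by (rule arg_cong[of _ _ "delta a"]) (auto simp: fun_eq_iff)
qed (simp add: weyl_act_1)

lemma list_exponent_sum:
  "(\<Sum>i\<leftarrow>[0..<length \<alpha>]. if v = Suc i then \<alpha> ! i else 0) = list_exponent \<alpha> v"
proof (cases v)
  case (Suc u)
  have "(\<Sum>i\<leftarrow>[0..<length \<alpha>]. if v = Suc i then \<alpha> ! i else 0) =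
      (\<Sum>i\<in>{0..<length \<alpha>}. if i = u then \<alpha> ! i else 0)"
    unfolding sum.list_conv_set_nth interv_sum_list_conv_sum_set_nat
    by (rule sum.cong) (auto simp: Suc)
  then show ?thesis by (simp add: list_exponent_def Suc)
qed (simp add: list_exponent_def)

text \<open>\<open>delta\<close> at the zero exponents is the constant function 1, and its image
  under \<open>P\<close> is the total symbol of \<open>P\<close>. The action is defined on the
  quotient, so these coefficients show that the normally ordered monomials are linearly
  independent.\<close>

definition weyl_coeff :: "'k::field weyl \<Rightarrow> nat list \<times> nat list \<Rightarrow> 'k" where
  "weyl_coeff P \<mu> = weyl_act P (delta (\<lambda>_. 0) (\<lambda>_. 0)) (list_exponent (fst \<mu>)) (list_exponent (snd \<mu>))"

lemma weyl_coeff_0 [simp]: "weyl_coeff 0 \<mu> = 0"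
  by (simp add: weyl_coeff_def weyl_act_0)

lemma weyl_coeff_add [simp]: "weyl_coeff (P + Q) \<mu> = weyl_coeff P \<mu> + weyl_coeff Q \<mu>"
  by (simp add: weyl_coeff_def weyl_act_add)

lemma weyl_coeff_scale [simp]: "weyl_coeff (weyl_scale c P) \<mu> = c * weyl_coeff P \<mu>"
  by (simp add: weyl_coeff_def weyl_act_scale)

lemma weyl_coeff_monomial:
  assumes "length \<alpha> = length (fst \<mu>)" "length \<beta> = length (snd \<mu>)"
  shows "weyl_coeff (weyl_monomial \<alpha> \<beta>) \<mu> = (if (\<alpha>, \<beta>) = \<mu> then 1 else (0 :: 'k::field))"
proof -
  have "weyl_act (weyl_monomial \<alpha> \<beta> :: 'k weyl) (delta (\<lambda>_. 0) (\<lambda>_. 0)) =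
      delta (list_exponent \<alpha>) (list_exponent \<beta>)"
    unfolding weyl_monomial_def weyl_act_mult weyl_act_d_prod_delta[where a = "\<lambda>_. 0", OF HOL.refl]
      weyl_act_x_prod_delta list_exponent_sum by simp
  then show ?thesis
    using list_exponent_inject[OF assms(1)] list_exponent_inject[OF assms(2)]
    by (auto simp: weyl_coeff_def delta_def prod_eq_iff)
qed

section \<open>Left multiplication of normally ordered monomials by generators\<close>

lemma weyl_const_add: "weyl_const (s + t) = weyl_const s + weyl_const t"
  by transfer (rule weq.sym[OF weq.const_plus])

lemma weyl_const_commute: "weyl_const c * P = P * weyl_const c"
  by transfer (rule weq.const_central)

lemma weyl_const_of_nat: "weyl_const (of_nat k) = of_nat k"
  by (induction k) (simp_all add: weyl_const_0 weyl_const_1 weyl_const_add)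

lemma weyl_scale_mult_right: "P * weyl_scale c Q = weyl_scale c (P * Q)"
  by (metis mult.assoc weyl_const_commute weyl_scale_def)

text \<open>\<open>y i\<close> moves past the earlier factors to the unique factor with index
  \<open>i\<close>; the lemma serves both the \<open>x\<close> and the \<open>\<partial>\<close>
  factors.\<close>

lemma commuting_prod_list_Suc:
  fixes y :: "nat \<Rightarrow> 'a::monoid_mult"
  assumes "\<And>i j. y i * y j = y j * y i" "e' i = Suc (e i)" "\<And>j. j \<noteq> i \<Longrightarrow> e' j = e j"
    and "distinct js" "i \<in> set js"
  shows "y i * (\<Prod>j\<leftarrow>js. y j ^ e j) = (\<Prod>j\<leftarrow>js. y j ^ e' j)"
  using assms(4,5)
proof (induction js)
  case (Cons k js)
  show ?case
  proof (cases "i = k")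
    case True
    then have "e' j = e j" if "j \<in> set js" for j
      using that Cons.prems assms(3)[of j] by auto
    then have "(\<Prod>j\<leftarrow>js. y j ^ e' j) = (\<Prod>j\<leftarrow>js. y j ^ e j)"
      by (simp cong: map_cong)
    then show ?thesis using True assms(2) by (simp add: mult.assoc)
  next
    case False
    have "y i * (y k ^ e k * (\<Prod>j\<leftarrow>js. y j ^ e j)) = y k ^ e k * (y i * (\<Prod>j\<leftarrow>js. y j ^ e j))"
      using power_commuting_commutes[OF assms(1)[of k i], of "e k"] by (simp flip: mult.assoc)
    then show ?thesis using Cons False assms(3) by auto
  qed
qed simp

lemma of_nat_left_commute:
  fixes p q :: "'a::semiring_1"
  shows "p * (of_nat k * q) = of_nat k * (p * q)"
proof -
  have "p * (of_nat k * q) = (p * of_nat k) * q"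
    by (rule mult.assoc[symmetric])
  also have "p * of_nat k = of_nat k * p"
    by (rule mult_of_nat_commute[symmetric])
  finally show ?thesis
    by (simp only: mult.assoc)
qed

text \<open>The commutator with a power is its formal derivative. For \<open>k = 0\<close> the
  truncated exponent \<open>k - 1\<close> is harmless, as its coefficient is 0.\<close>

lemma d_times_x_power:
  "\<partial> i * weyl_x j ^ k =
    (weyl_x j ^ k * \<partial> i + (if i = j then of_nat k * weyl_x j ^ (k - 1) else 0) :: 'k::field weyl)"
proof (induction k)
  case (Suc k)
  let ?d = "\<partial> i :: 'k weyl" and ?x = "weyl_x j :: 'k weyl"
  have x: "?x * (of_nat k * ?x ^ (k - 1)) = of_nat k * ?x ^ k"
  proof (cases k)
    case (Suc l)
    then show ?thesis
      by (simp add: of_nat_left_commute del: of_nat_Suc)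
  qed simp
  have dx: "?d * ?x = ?x * ?d + (if i = j then 1 else 0)"
    using weyl_relations(3)[of i j, where 'c = 'k] by (simp add: diff_eq_eq add.commute)
  have "?d * ?x ^ Suc k = (?d * ?x) * ?x ^ k"
    by (simp add: mult.assoc)
  also have "\<dots> = ?x * (?d * ?x ^ k) + (if i = j then ?x ^ k else 0)"
    unfolding dx by (simp add: ring_distribs mult.assoc)
  also have "\<dots> = ?x ^ Suc k * ?d + (if i = j then of_nat (Suc k) * ?x ^ k else 0)"
    unfolding Suc.IH using x by (simp add: ring_distribs mult.assoc)
  finally show ?case by simp
qed simp

lemma d_times_x_prod:
  assumes "e' i = e i - 1" "\<And>j. j \<noteq> i \<Longrightarrow> e' j = e j" "distinct js"
  shows "\<partial> (Suc i) * (\<Prod>j\<leftarrow>js. weyl_x (Suc j) ^ e j) =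
    (\<Prod>j\<leftarrow>js. weyl_x (Suc j) ^ e j) * \<partial> (Suc i) +
    (if i \<in> set js then of_nat (e i) * (\<Prod>j\<leftarrow>js. weyl_x (Suc j) ^ e' j) else 0 :: 'k::field weyl)"
  using assms(3)
proof (induction js)
  case (Cons k js)
  let ?p = "\<Prod>j\<leftarrow>js. weyl_x (Suc j) ^ e j :: 'k weyl"
    and ?q = "\<Prod>j\<leftarrow>js. weyl_x (Suc j) ^ e' j :: 'k weyl"
  have "\<partial> (Suc i) * (weyl_x (Suc k) ^ e k * ?p) = (\<partial> (Suc i) * weyl_x (Suc k) ^ e k) * ?p"
    by (simp add: mult.assoc)
  also have "\<dots> = weyl_x (Suc k) ^ e k * (\<partial> (Suc i) * ?p) +
      (if i = k then of_nat (e k) * (weyl_x (Suc k) ^ (e k - 1) * ?p) else 0)"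
    unfolding d_times_x_power by (simp add: ring_distribs mult.assoc)
  finally have *: "\<partial> (Suc i) * (weyl_x (Suc k) ^ e k * ?p) = \<dots>" .
  show ?case
  proof (cases "i = k")
    case True
    then have "e' j = e j" if "j \<in> set js" for j
      using that Cons.prems assms(2)[of j] by auto
    then have "?q = ?p"
      by (simp cong: map_cong)
    then show ?thesis using True Cons * assms(1) by (simp add: mult.assoc)
  next
    case False
    have "weyl_x (Suc k) ^ e k * (of_nat (e i) * ?q) = of_nat (e i) * (weyl_x (Suc k) ^ e k * ?q)"
      by (rule of_nat_left_commute)
    with False show ?thesis using Cons * assms(2)[of k] by (simp add: ring_distribs mult.assoc)
  qed
qed simp

lemma x_times_monomial:
  assumes "i < length \<alpha>"
  shows "weyl_x (Suc i) * weyl_monomial \<alpha> \<beta> = (weyl_monomial (\<alpha>[i := Suc (\<alpha> ! i)]) \<beta> :: 'k::field weyl)"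
proof -
  have "(weyl_x (Suc i) :: 'k weyl) * (\<Prod>j\<leftarrow>[0..<length \<alpha>]. weyl_x (Suc j) ^ (\<alpha> ! j)) =
      (\<Prod>j\<leftarrow>[0..<length \<alpha>]. weyl_x (Suc j) ^ (\<alpha>[i := Suc (\<alpha> ! i)] ! j))"
    by (rule commuting_prod_list_Suc[where y = "\<lambda>j. weyl_x (Suc j)" and i = i, OF weyl_relations(1)])
      (use assms in simp_all)
  then show ?thesis
    by (simp add: weyl_monomial_def flip: mult.assoc)
qed

text \<open>A generator on the left yields at most two normally ordered terms. Words are therefore
  expanded letter by letter, and no product of two general operators has to be computed.\<close>

lemma d_times_monomial:
  assumes "i < length \<alpha>" "i < length \<beta>"
  shows "\<partial> (Suc i) * weyl_monomial \<alpha> \<beta> =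
    weyl_scale (of_nat (\<alpha> ! i)) (weyl_monomial (\<alpha>[i := \<alpha> ! i - 1]) \<beta>) +
    (weyl_monomial \<alpha> (\<beta>[i := Suc (\<beta> ! i)]) :: 'k::field weyl)"
proof -
  let ?x = "\<lambda>\<gamma>. \<Prod>j\<leftarrow>[0..<length \<alpha>]. weyl_x (Suc j) ^ (\<gamma> ! j) :: 'k weyl"
  let ?d = "\<lambda>\<gamma>. \<Prod>j\<leftarrow>[0..<length \<beta>]. \<partial> (Suc j) ^ (\<gamma> ! j) :: 'k weyl"
  have x: "\<partial> (Suc i) * ?x \<alpha> = ?x \<alpha> * \<partial> (Suc i) + of_nat (\<alpha> ! i) * ?x (\<alpha>[i := \<alpha> ! i - 1])"
    by (subst d_times_x_prod[of "(!) (\<alpha>[i := \<alpha> ! i - 1])" i "(!) \<alpha>"]) (use assms(1) in simp_all)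
  have d: "\<partial> (Suc i) * ?d \<beta> = ?d (\<beta>[i := Suc (\<beta> ! i)])"
    by (rule commuting_prod_list_Suc[where y = "\<lambda>j. \<partial> (Suc j)" and i = i, OF weyl_relations(2)])
      (use assms in simp_all)
  have "\<partial> (Suc i) * weyl_monomial \<alpha> \<beta> = (\<partial> (Suc i) * ?x \<alpha>) * ?d \<beta>"
    by (simp add: weyl_monomial_def mult.assoc)
  also have "\<dots> = ?x \<alpha> * (\<partial> (Suc i) * ?d \<beta>) + of_nat (\<alpha> ! i) * (?x (\<alpha>[i := \<alpha> ! i - 1]) * ?d \<beta>)"
    by (simp only: x ring_distribs mult.assoc)
  also have "\<dots> = of_nat (\<alpha> ! i) * weyl_monomial (\<alpha>[i := \<alpha> ! i - 1]) \<beta> +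
      weyl_monomial \<alpha> (\<beta>[i := Suc (\<beta> ! i)])"
    unfolding d by (simp add: weyl_monomial_def)
  finally show ?thesis
    by (simp only: weyl_scale_def weyl_const_of_nat)
qed

section \<open>Elimination\<close>

definition wf_terms :: "nat \<Rightarrow> 'k terms \<Rightarrow> bool" where
  "wf_terms n ts \<longleftrightarrow> (\<forall>t\<in>set ts. length (fst (snd t)) = n \<and> length (snd (snd t)) = n)"

definition operator_of :: "'k::field terms \<Rightarrow> 'k weyl" where
  "operator_of ts = (\<Sum>t\<leftarrow>ts. weyl_scale (fst t) (weyl_monomial (fst (snd t)) (snd (snd t))))"

lemma represents_iff: "represents n ts P \<longleftrightarrow> wf_terms n ts \<and> P = operator_of ts"
  by (simp add: represents_def wf_terms_def operator_of_def case_prod_unfold)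

definition scale_terms :: "'k::field \<Rightarrow> 'k terms \<Rightarrow> 'k terms" where
  "scale_terms c ts = map (\<lambda>t. (c * fst t, snd t)) ts"

definition x_mult :: "nat \<Rightarrow> 'k terms \<Rightarrow> 'k terms" where
  "x_mult i ts = map (\<lambda>t. (fst t, (fst (snd t))[i := Suc (nth_default 0 (fst (snd t)) i)], snd (snd t))) ts"

text \<open>At exponent 0 the truncated subtraction leaves 0, but the coefficient of that term is 0;
  since lists need not be reduced, the term is kept.\<close>

definition d_mult :: "nat \<Rightarrow> 'k::field terms \<Rightarrow> 'k terms" where
  "d_mult i ts = concat (map (\<lambda>t.
     [(fst t * of_nat (nth_default 0 (fst (snd t)) i),
        (fst (snd t))[i := nth_default 0 (fst (snd t)) i - 1], snd (snd t)),
      (fst t, fst (snd t), (snd (snd t))[i := Suc (nth_default 0 (snd (snd t)) i)])]) ts)"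

lemma wf_terms_simps [simp]:
  "wf_terms n []"
  "wf_terms n (t # ts) \<longleftrightarrow> length (fst (snd t)) = n \<and> length (snd (snd t)) = n \<and> wf_terms n ts"
  "wf_terms n (ts @ us) \<longleftrightarrow> wf_terms n ts \<and> wf_terms n us"
  "wf_terms n (scale_terms c ts) \<longleftrightarrow> wf_terms n ts"
  "wf_terms n (x_mult i ts) \<longleftrightarrow> wf_terms n ts"
  "wf_terms n (d_mult i ts) \<longleftrightarrow> wf_terms n ts"
  by (auto simp: wf_terms_def scale_terms_def x_mult_def d_mult_def)

lemma operator_of_simps [simp]:
  "operator_of [] = 0"
  "operator_of (t # ts) = weyl_scale (fst t) (weyl_monomial (fst (snd t)) (snd (snd t))) + operator_of ts"
  "operator_of (ts @ us) = operator_of ts + operator_of us"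
  by (simp_all add: operator_of_def)

lemma operator_of_scale_terms [simp]: "operator_of (scale_terms c ts) = weyl_scale c (operator_of ts)"
  by (induction ts) (simp_all add: scale_terms_def weyl.scale_right_distrib)

lemma operator_of_x_mult:
  assumes "wf_terms n ts" "i < n"
  shows "operator_of (x_mult i ts) = weyl_x (Suc i) * operator_of ts"
  using assms(1)
proof (induction ts)
  case (Cons t ts)
  have "x_mult i (t # ts) =
      (fst t, (fst (snd t))[i := Suc (nth_default 0 (fst (snd t)) i)], snd (snd t)) # x_mult i ts"
    by (simp add: x_mult_def)
  then show ?case
    using Cons assms(2)
    by (simp add: ring_distribs weyl_scale_mult_right x_times_monomial nth_default_nth)
qed (simp add: x_mult_def)

lemma operator_of_d_mult:
  assumes "wf_terms n ts" "i < n"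
  shows "operator_of (d_mult i ts) = \<partial> (Suc i) * operator_of ts"
  using assms(1)
proof (induction ts)
  case (Cons t ts)
  have "d_mult i (t # ts) =
      (fst t * of_nat (nth_default 0 (fst (snd t)) i),
        (fst (snd t))[i := nth_default 0 (fst (snd t)) i - 1], snd (snd t)) #
      (fst t, fst (snd t), (snd (snd t))[i := Suc (nth_default 0 (snd (snd t)) i)]) # d_mult i ts"
    by (simp add: d_mult_def)
  then show ?case
    using Cons assms(2)
    by (simp add: ring_distribs weyl_scale_mult_right d_times_monomial nth_default_nth
        weyl.scale_right_distrib add.assoc)
qed (simp add: d_mult_def)

definition coeff_terms :: "'k::field terms \<Rightarrow> nat list \<times> nat list \<Rightarrow> 'k" where
  "coeff_terms ts \<mu> = (\<Sum>t\<leftarrow>ts. if snd t = \<mu> then fst t else 0)"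

text \<open>\<open>weyl_coeff\<close> sees only the operator, so collected coefficients agree for
  all well-formed lists of one operator.\<close>

lemma weyl_coeff_operator_of:
  assumes "wf_terms n ts" "length (fst \<mu>) = n" "length (snd \<mu>) = n"
  shows "weyl_coeff (operator_of ts) \<mu> = coeff_terms ts \<mu>"
  using assms(1) by (induction ts) (auto simp: coeff_terms_def weyl_coeff_monomial assms(2,3))

lemma operator_of_conv_sum:
  assumes "finite M" "snd ` set ts \<subseteq> M"
  shows "operator_of ts = (\<Sum>\<mu>\<in>M. weyl_scale (coeff_terms ts \<mu>) (weyl_monomial (fst \<mu>) (snd \<mu>)))"
  using assms(2)
proof (induction ts)
  case (Cons t ts)
  let ?m = "\<lambda>\<mu>. weyl_monomial (fst \<mu>) (snd \<mu>) :: 'a weyl"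
  have "weyl_scale (coeff_terms (t # ts) \<mu>) (?m \<mu>) =
      (if snd t = \<mu> then weyl_scale (fst t) (?m \<mu>) else 0) + weyl_scale (coeff_terms ts \<mu>) (?m \<mu>)" for \<mu>
    by (simp add: coeff_terms_def weyl.scale_left_distrib)
  moreover have "(\<Sum>\<mu>\<in>M. if snd t = \<mu> then weyl_scale (fst t) (?m \<mu>) else 0) = weyl_scale (fst t) (?m (snd t))"
    using assms(1) Cons.prems by (simp add: sum.delta')
  ultimately show ?case
    using Cons by (simp add: sum.distrib)
qed (simp add: coeff_terms_def)

text \<open>Terms with the same monomial may cancel, hence the test on collected coefficients.
  Emptiness of this list is the zero test, and its head supplies the pivot monomial.\<close>

definition pivots :: "'k::field terms \<Rightarrow> 'k terms" where
  "pivots ts = filter (\<lambda>t. coeff_terms ts (snd t) \<noteq> 0) ts"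

text \<open>One direction groups the terms by monomial; the other is linear independence of the
  normally ordered monomials.\<close>

lemma pivots_eq_Nil_iff:
  assumes "wf_terms n ts"
  shows "pivots ts = [] \<longleftrightarrow> operator_of ts = 0"
proof
  assume "pivots ts = []"
  then have "coeff_terms ts \<mu> = 0" if "\<mu> \<in> snd ` set ts" for \<mu>
    using that by (auto simp: pivots_def filter_empty_conv)
  then show "operator_of ts = 0"
    using operator_of_conv_sum[of "snd ` set ts" ts] by simp
next
  assume *: "operator_of ts = 0"
  have "coeff_terms ts (snd t) = 0" if "t \<in> set ts" for t
    using weyl_coeff_operator_of[OF assms, of "snd t"] that assms by (simp add: * wf_terms_def)
  then show "pivots ts = []"
    by (simp add: pivots_def filter_empty_conv)
qed

text \<open>
  A pair \<open>(v, w)\<close> consists of an operator \<open>v\<close> and a list \<open>w\<close> of terms tagged with an index \<open>i\<close>; the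
  terms with tag \<open>i\<close> form the component of \<open>w\<close> that stands under \<open>\<partial>\<^bsub>i+1\<^esub>\<close>.
\<close>

type_synonym 'k tagged = "'k terms \<times> (nat \<times> 'k \<times> nat list \<times> nat list) list"

definition component :: "nat \<Rightarrow> (nat \<times> 'k \<times> nat list \<times> nat list) list \<Rightarrow> 'k terms" where
  "component i w = map snd (filter (\<lambda>e. fst e = i) w)"

definition wf_tagged :: "nat \<Rightarrow> 'k tagged \<Rightarrow> bool" where
  "wf_tagged n v \<longleftrightarrow> wf_terms n (fst v) \<and> wf_terms n (map snd (snd v))"

text \<open>A well-formed pair with defect in \<open>I\<close> certifies that its operator lies in
  \<open>I\<close> plus the sum of the \<open>\<partial>\<^sub>i D\<close>; this is the invariant of
  the elimination.\<close>

definition defect :: "nat \<Rightarrow> 'k::field tagged \<Rightarrow> 'k weyl" where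
  "defect m v = operator_of (fst v) - (\<Sum>i<m. \<partial> (Suc i) * operator_of (component i (snd v)))"

text \<open>Thanks to the tags, all components are added by one concatenation.\<close>

definition add_scaled :: "'k::field tagged \<Rightarrow> 'k \<Rightarrow> 'k tagged \<Rightarrow> 'k tagged" where
  "add_scaled u c v = (fst u @ scale_terms c (fst v),
     snd u @ map (\<lambda>e. (fst e, c * fst (snd e), snd (snd e))) (snd v))"

lemma operator_of_component_add_scaled:
  "operator_of (component i (snd (add_scaled u c v))) =
     operator_of (component i (snd u)) + weyl_scale c (operator_of (component i (snd v)))"
proof -
  have "component i (map (\<lambda>e. (fst e, c * fst (snd e), snd (snd e))) w) = scale_terms c (component i w)" for w
    by (induction w) (auto simp: component_def scale_terms_def)
  then show ?thesis
    by (simp add: add_scaled_def component_def flip: operator_of_scale_terms)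
qed

lemma defect_add_scaled: "defect m (add_scaled u c v) = defect m u + weyl_scale c (defect m v)"
  by (simp add: defect_def operator_of_component_add_scaled ring_distribs sum.distrib
      weyl_scale_mult_right weyl.scale_right_diff_distrib weyl.scale_sum_right)
    (simp add: add_scaled_def)

lemma wf_add_scaled: "wf_tagged n u \<Longrightarrow> wf_tagged n v \<Longrightarrow> wf_tagged n (add_scaled u c v)"
  by (auto simp: wf_tagged_def add_scaled_def wf_terms_def scale_terms_def)

definition reduce :: "'k::field tagged \<Rightarrow> 'k tagged \<Rightarrow> 'k tagged" where
  "reduce v u = (case pivots (fst v) of
      [] \<Rightarrow> u
    | t # ts \<Rightarrow> add_scaled u (- (coeff_terms (fst u) (snd t) / coeff_terms (fst v) (snd t))) v)"

definition elim_step :: "'k::field tagged list \<times> 'k tagged \<Rightarrow> 'k tagged list \<times> 'k tagged" where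
  "elim_step s = (case fst s of [] \<Rightarrow> s | v # us \<Rightarrow> (map (\<lambda>u. reduce v u) us, reduce v (snd s)))"

text \<open>The remaining list changes in every step, so this is an iteration and not a fold over
  \<open>vs\<close>. Each step drops one entry, hence \<open>length vs\<close> steps.\<close>

definition eliminate :: "'k::field tagged list \<Rightarrow> 'k tagged \<Rightarrow> 'k tagged" where
  "eliminate vs r = snd ((elim_step ^^ length vs) (vs, r))"

lemma eliminate_simps [simp]:
  "eliminate [] r = r"
  "eliminate (v # vs) r = eliminate (map (reduce v) vs) (reduce v r)"
  by (simp_all add: eliminate_def elim_step_def funpow_Suc_right del: funpow.simps)

lemma wf_reduce: "wf_tagged n u \<Longrightarrow> wf_tagged n v \<Longrightarrow> wf_tagged n (reduce v u)"
  by (auto simp: reduce_def wf_add_scaled split: list.split)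

section \<open>Correctness of the elimination\<close>

locale weyl_left_ideal =
  fixes n :: nat and I :: "'k::field weyl set"
  assumes left_ideal: "left_ideal (weyl_algebra {1..n}) I"
begin

lemma zero_mem: "0 \<in> I" and add_mem: "a \<in> I \<Longrightarrow> b \<in> I \<Longrightarrow> a + b \<in> I"
  and mult_mem: "P \<in> weyl_algebra {1..n} \<Longrightarrow> a \<in> I \<Longrightarrow> P * a \<in> I"
  using left_ideal by (auto simp: left_ideal_def)

lemma scale_mem: "a \<in> I \<Longrightarrow> weyl_scale c a \<in> I"
  unfolding weyl_scale_def by (intro mult_mem weyl_algebra.intros)

lemma uminus_mem: "a \<in> I \<Longrightarrow> - a \<in> I"
  using scale_mem[of a "-1"] by simp

lemma defect_reduce:
  assumes "defect m v \<in> I"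
  shows "defect m (reduce v u) - defect m u \<in> I"
  using assms by (auto simp: reduce_def defect_add_scaled zero_mem split: list.split intro!: scale_mem uminus_mem)

text \<open>Only scalar multiples of entries with defect in \<open>I\<close> are added, whatever the
  pivots. The induction is on the length because the tail is replaced by its reduced form.\<close>

lemma eliminate_sound:
  assumes "\<And>v. v \<in> set vs \<Longrightarrow> wf_tagged n v \<and> defect m v \<in> I" "wf_tagged n r"
  shows "wf_tagged n (eliminate vs r) \<and> defect m (eliminate vs r) - defect m r \<in> I"
  using assms
proof (induction "length vs" arbitrary: vs r)
  case 0
  then show ?case by (simp add: zero_mem)
next
  case (Suc l)
  then obtain v us where vs: "vs = v # us" by (cases vs) auto
  have v: "wf_tagged n v" "defect m v \<in> I"
    using Suc.prems(1) vs by auto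
  have "wf_tagged n (reduce v u) \<and> defect m (reduce v u) \<in> I" if "u \<in> set us" for u
    using Suc.prems(1)[of u] that wf_reduce[OF _ v(1), of u]
      add_mem[OF defect_reduce[OF v(2), of u], of "defect m u"] by (simp add: vs)
  then have "wf_tagged n u \<and> defect m u \<in> I" if "u \<in> set (map (reduce v) us)" for u
    using that by auto
  then have "wf_tagged n (eliminate vs r) \<and> defect m (eliminate vs r) - defect m (reduce v r) \<in> I"
    using Suc.hyps(1)[of "map (reduce v) us" "reduce v r"] Suc.hyps(2) wf_reduce[OF Suc.prems(2) v(1)]
    by (simp add: vs)
  then show ?case
    using add_mem[OF _ defect_reduce[OF v(2), of r], of "defect m (eliminate vs r) - defect m (reduce v r)"]
    by simp
qed

end

lemma weyl_span_image:
  assumes add: "\<And>x y. h (x + y) = h x + h y" and scale: "\<And>c x. h (weyl_scale c x) = weyl_scale c (h x)"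
    and "x \<in> weyl_span S"
  shows "h x \<in> weyl_span (h ` S)"
  using assms(3)
proof (induction rule: weyl.span_induct_alt)
  case base
  have "h 0 = 0" using scale[of 0 0] by simp
  then show ?case by (simp add: weyl.span_zero)
next
  case (step c x y)
  then show ?case by (simp add: add scale weyl.span_add weyl.span_scale weyl.span_base)
qed

text \<open>Reducing by \<open>v\<close> acts on operators as a linear map that kills
  \<open>v\<close>, so it sends the span of the whole list into the span of the reduced tail. In the
  end the remainder lies in the span of the empty set.\<close>

lemma eliminate_complete:
  assumes "\<And>v. v \<in> set vs \<Longrightarrow> wf_tagged n v" "wf_tagged n r"
    and "operator_of (fst r) \<in> weyl_span ((\<lambda>v. operator_of (fst v)) ` set vs)"
  shows "operator_of (fst (eliminate vs r)) = 0"
  using assms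
proof (induction "length vs" arbitrary: vs r)
  case 0
  then show ?case by simp
next
  case (Suc l)
  let ?op = "\<lambda>v :: 'a tagged. operator_of (fst v)"
  from Suc.hyps(2) obtain v us where vs: "vs = v # us" by (cases vs) auto
  have wf: "wf_tagged n v" "\<And>u. u \<in> set us \<Longrightarrow> wf_tagged n u"
    using Suc.prems(1) vs by auto
  have "?op (reduce v r) \<in> weyl_span (?op ` set (map (reduce v) us))"
  proof (cases "pivots (fst v)")
    case Nil
    then have "?op v = 0"
      using pivots_eq_Nil_iff wf(1) by (auto simp: wf_tagged_def)
    then show ?thesis
      using Suc.prems(3) Nil by (simp add: vs reduce_def weyl.span_insert_0)
  next
    case (Cons t ts)
    define \<mu> where "\<mu> = snd t"
    \<comment> \<open>With \<open>weyl_coeff\<close> in place of \<open>coeff_terms\<close>,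
      \<open>h\<close> is a function of the operator alone and is linear.\<close>
    define h where "h = (\<lambda>P. P + weyl_scale (- (weyl_coeff P \<mu> / weyl_coeff (?op v) \<mu>)) (?op v))"
    have "t \<in> set (pivots (fst v))" using Cons by simp
    then have t: "t \<in> set (fst v)" "coeff_terms (fst v) \<mu> \<noteq> 0"
      by (auto simp: pivots_def \<mu>_def)
    have len: "length (fst \<mu>) = n" "length (snd \<mu>) = n"
      using t(1) wf(1) by (auto simp: wf_tagged_def wf_terms_def \<mu>_def)
    have coeff: "weyl_coeff (?op u) \<mu> = coeff_terms (fst u) \<mu>" if "wf_tagged n u" for u :: "'a tagged"
      using that len by (auto simp: wf_tagged_def weyl_coeff_operator_of)
    have h_reduce: "?op (reduce v u) = h (?op u)" if "wf_tagged n u" for u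
      using that coeff wf(1) Cons
      by (simp add: reduce_def h_def add_scaled_def \<mu>_def flip: operator_of_scale_terms)
    have "h (?op v) = 0"
      using t(2) by (simp add: h_def coeff wf(1))
    moreover have "h (?op r) \<in> weyl_span (h ` ?op ` set vs)"
      by (rule weyl_span_image[OF _ _ Suc.prems(3)])
        (simp_all add: h_def algebra_simps add_divide_distrib weyl.scale_left_distrib
          weyl.scale_left_diff_distrib weyl.scale_right_diff_distrib)
    moreover have "h ` ?op ` set us = ?op ` set (map (reduce v) us)"
      using h_reduce wf(2) by (auto simp: image_image)
    ultimately show ?thesis
      using h_reduce[OF Suc.prems(2)] by (simp add: vs weyl.span_insert_0)
  qed
  moreover have "wf_tagged n u" if "u \<in> set (map (reduce v) us)" for u
    using that wf_reduce[OF wf(2) wf(1)] by auto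
  ultimately show ?case
    using Suc.hyps(1)[of "map (reduce v) us" "reduce v r"] Suc.hyps(2) wf_reduce[OF Suc.prems(2) wf(1)]
    by (simp add: vs)
qed

section \<open>Words and the spaces they span\<close>

definition extend_words :: "nat \<Rightarrow> 'k::field terms list \<Rightarrow> 'k terms list" where
  "extend_words n ws = ws @ concat (map (\<lambda>i. map (\<lambda>u. x_mult i u) ws @ map (\<lambda>u. d_mult i u) ws) [0..<n])"

text \<open>Starting from generators of \<open>I\<close> this gives the operators
  \<open>u g\<close>, starting from 1 the words \<open>u\<close> themselves.\<close>

definition words :: "nat \<Rightarrow> 'k::field terms list \<Rightarrow> nat \<Rightarrow> 'k terms list" where
  "words n us k = (extend_words n ^^ k) us"

lemma words_Suc: "words n us (Suc k) = extend_words n (words n us k)"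
  by (simp add: words_def)

lemma words_subset_Suc: "set (words n us k) \<subseteq> set (words n us (Suc k))"
  by (auto simp: words_Suc extend_words_def)

lemma words_induct [consumes 1, case_names base x_mult d_mult]:
  assumes "u \<in> set (words n us k)"
    and "\<And>u. u \<in> set us \<Longrightarrow> P u"
    and "\<And>i u. i < n \<Longrightarrow> P u \<Longrightarrow> P (x_mult i u)"
    and "\<And>i u. i < n \<Longrightarrow> P u \<Longrightarrow> P (d_mult i u)"
  shows "P u"
  using assms(1)
proof (induction k arbitrary: u)
  case 0
  then show ?case using assms(2) by (simp add: words_def)
next
  case (Suc k)
  then show ?case using assms(3,4) by (auto simp: words_Suc extend_words_def)
qed

definition word_space :: "nat \<Rightarrow> 'k::field terms list \<Rightarrow> 'k weyl set" where
  "word_space n us = weyl_span (operator_of ` (\<Union>k. set (words n us k)))"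

text \<open>A generator maps each spanning operator to one found a level higher. In the product case
  the hypothesis for \<open>P\<close> is applied to \<open>Q * a\<close>, so \<open>a\<close> is
  kept arbitrary.\<close>

lemma word_space_mult:
  assumes wf: "\<And>u. u \<in> set us \<Longrightarrow> wf_terms n u"
    and "P \<in> weyl_algebra {1..n}" "a \<in> word_space n us"
  shows "P * a \<in> word_space n us"
  using assms(2,3)
proof (induction arbitrary: a)
  case (1 c)
  then show ?case by (simp add: word_space_def weyl.span_scale flip: weyl_scale_def)
next
  case (2 i)
  let ?V = "operator_of ` (\<Union>k. set (words n us k)) :: 'a weyl set"
  have "weyl_x i * b \<in> ?V" if "b \<in> ?V" for b
  proof -
    from that obtain u k where u: "b = operator_of u" "u \<in> set (words n us k)" by auto
    have "wf_terms n u" using u(2) by (induction rule: words_induct) (simp_all add: wf)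
    then have "weyl_x i * b = operator_of (x_mult (i - 1) u)"
      using 2(1) operator_of_x_mult[of n u "i - 1"] by (cases i) (simp_all add: u(1) Suc_le_eq)
    moreover have "x_mult (i - 1) u \<in> set (words n us (Suc k))"
      using u(2) 2(1) by (force simp: words_Suc extend_words_def)
    ultimately show ?thesis by blast
  qed
  then show ?case
    using weyl_span_image[of "\<lambda>b. weyl_x i * b" a ?V] 2(2)
      weyl.span_mono[of "(\<lambda>b. weyl_x i * b) ` ?V" ?V]
    by (auto simp: word_space_def ring_distribs weyl_scale_mult_right)
next
  case (3 i)
  let ?V = "operator_of ` (\<Union>k. set (words n us k)) :: 'a weyl set"
  have "\<partial> i * b \<in> ?V" if "b \<in> ?V" for b
  proof -
    from that obtain u k where u: "b = operator_of u" "u \<in> set (words n us k)" by auto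
    have "wf_terms n u" using u(2) by (induction rule: words_induct) (simp_all add: wf)
    then have "\<partial> i * b = operator_of (d_mult (i - 1) u)"
      using 3(1) operator_of_d_mult[of n u "i - 1"] by (cases i) (simp_all add: u(1) Suc_le_eq)
    moreover have "d_mult (i - 1) u \<in> set (words n us (Suc k))"
      using u(2) 3(1) by (force simp: words_Suc extend_words_def)
    ultimately show ?thesis by blast
  qed
  then show ?case
    using weyl_span_image[of "\<lambda>b. \<partial> i * b" a ?V] 3(2)
      weyl.span_mono[of "(\<lambda>b. \<partial> i * b) ` ?V" ?V]
    by (auto simp: word_space_def ring_distribs weyl_scale_mult_right)
next
  case (4 P Q)
  then show ?case by (simp add: ring_distribs word_space_def weyl.span_add)
next
  case (5 P Q)
  then show ?case by (simp add: mult.assoc)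
qed

lemma operator_of_mem_word_space: "u \<in> set us \<Longrightarrow> operator_of u \<in> word_space n us"
  unfolding word_space_def by (intro weyl.span_base imageI UN_I[of 0]) (simp_all add: words_def)

lemma list_all2_represents:
  assumes "list_all2 (represents n) gs G"
  shows "g \<in> set gs \<Longrightarrow> wf_terms n g" and "set G = operator_of ` set gs"
  using assms by (induction rule: list_all2_induct) (auto simp: represents_iff)

lemma left_ideal_generated_subset:
  assumes "list_all2 (represents n) gs G" "set G \<subseteq> weyl_algebra {1..n}"
  shows "left_ideal_generated (weyl_algebra {1..n}) (set G) \<subseteq> word_space n gs"
proof -
  have gs: "wf_terms n g" if "g \<in> set gs" for g
    using list_all2_represents[OF assms(1)] that by blast
  have "a \<in> word_space n gs" if "a \<in> set G" for a
    using that unfolding list_all2_represents(2)[OF assms(1)]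
    by (auto intro: operator_of_mem_word_space)
  moreover have "weyl_const 0 \<in> weyl_algebra {1..n}" by (rule weyl_algebra.intros)
  \<comment> \<open>The intersection provides the inclusion in the algebra that
    \<open>left_ideal\<close> asks for.\<close>
  then have "left_ideal (weyl_algebra {1..n}) (word_space n gs \<inter> weyl_algebra {1..n})"
    unfolding left_ideal_def using word_space_mult[OF gs]
    by (auto simp: weyl_const_0 word_space_def weyl.span_zero weyl.span_add intro: weyl_algebra.intros(4,5))
  ultimately show ?thesis
    unfolding left_ideal_generated_def using assms(2)
    by (intro subset_trans[OF hull_minimal]) auto
qed

definition one_terms :: "nat \<Rightarrow> 'k::field terms" where
  "one_terms n = [(1, map (\<lambda>_. 0) [0..<n], map (\<lambda>_. 0) [0..<n])]"

lemma wf_one_terms: "wf_terms n (one_terms n)"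
  by (simp add: one_terms_def)

lemma operator_of_one_terms: "operator_of (one_terms n) = 1"
proof -
  have "(\<Prod>i\<leftarrow>[0..<n]. y i ^ (map (\<lambda>_. 0) [0..<n] ! i)) = 1" for y :: "nat \<Rightarrow> 'a weyl"
    by (subst map_cong[OF HOL.refl, of _ _ "\<lambda>_. 1"]) (simp_all add: map_replicate_const)
  then show ?thesis
    by (simp add: one_terms_def weyl_monomial_def)
qed

lemma weyl_algebra_subset_word_space: "weyl_algebra {1..n} \<subseteq> word_space n [one_terms n]"
  using word_space_mult[of "[one_terms n]" n _ 1] operator_of_mem_word_space[of "one_terms n" "[one_terms n]" n]
  by (auto simp: wf_one_terms operator_of_one_terms)

text \<open>An entry of the first kind has defect \<open>u\<close> itself, in \<open>I\<close>; one
  of the second kind has defect 0, as \<open>u\<close> is recorded under its own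
  \<open>\<partial>\<close>.\<close>

definition spanning_list :: "nat \<Rightarrow> nat \<Rightarrow> 'k::field terms list \<Rightarrow> nat \<Rightarrow> 'k tagged list" where
  "spanning_list n m gs k =
     map (\<lambda>u. (u, [])) (words n gs k) @
     concat (map (\<lambda>i. map (\<lambda>u. (d_mult i u, map (\<lambda>t. (i, t)) u)) (words n [one_terms n] k)) [0..<m])"

lemma spanning_list_mono:
  assumes "k \<le> l"
  shows "set (spanning_list n m gs k) \<subseteq> set (spanning_list n m gs l)"
proof -
  have "set (words n us k) \<subseteq> set (words n us l)" for us :: "'a terms list"
    by (rule lift_Suc_mono_le[of "\<lambda>k. set (words n us k)", OF words_subset_Suc assms])
  then show ?thesis
    unfolding spanning_list_def by (simp, blast)
qed

lemma (in weyl_left_ideal) spanning_list_sound: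
  assumes "\<And>g. g \<in> set gs \<Longrightarrow> wf_terms n g \<and> operator_of g \<in> I" "m \<le> n"
    and "v \<in> set (spanning_list n m gs k)"
  shows "wf_tagged n v \<and> defect m v \<in> I"
proof -
  have ideal_words: "wf_terms n u \<and> operator_of u \<in> I" if "u \<in> set (words n gs k)" for u
    using that
    by (induction rule: words_induct)
      (auto simp: assms(1) operator_of_x_mult operator_of_d_mult intro!: mult_mem weyl_algebra.intros)
  have words: "wf_terms n u" if "u \<in> set (words n [one_terms n] k)" for u :: "'k terms"
    using that by (induction rule: words_induct) (simp_all add: wf_one_terms)
  from assms(3) consider u where "v = (u, [])" "u \<in> set (words n gs k)"
    | i u where "i < m" "u \<in> set (words n [one_terms n] k)" "v = (d_mult i u, map (\<lambda>t. (i, t)) u)"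
    by (auto simp: spanning_list_def)
  then show ?thesis
  proof cases
    case 1
    then show ?thesis
      using ideal_words[of u] by (simp add: wf_tagged_def defect_def component_def)
  next
    case 2
    have "component j (map (\<lambda>t. (i, t)) u) = (if j = i then u else [])" for j
      by (induction u) (auto simp: component_def)
    then have "(\<Sum>j<m. \<partial> (Suc j) * operator_of (component j (map (\<lambda>t. (i, t)) u))) =
        (\<Sum>j<m. if j = i then \<partial> (Suc i) * operator_of u else 0)"
      by (intro sum.cong) auto
    then show ?thesis
      using 2 words[of u] assms(2) zero_mem
      by (simp add: wf_tagged_def defect_def operator_of_d_mult comp_def)
  qed
qed

text \<open>By linearity both summands reduce to words: \<open>I\<close> lies in the span of words
  applied to its generators, and \<open>D\<close> in the span of words applied to 1.\<close>

lemma (in weyl_left_ideal) spanning_list_complete: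
  assumes "I = left_ideal_generated (weyl_algebra {1..n}) (set G)" "list_all2 (represents n) gs G"
    and "m \<le> n" "p \<in> integration_ideal n m I"
  obtains k where "p \<in> weyl_span ((\<lambda>v. operator_of (fst v)) ` set (spanning_list n m gs k))"
proof -
  let ?op = "\<lambda>v :: 'k tagged. operator_of (fst v)"
  let ?W = "\<Union>k. ?op ` set (spanning_list n m gs k)"
  have "set G \<subseteq> weyl_algebra {1..n}"
    using hull_subset[of "set G" "left_ideal (weyl_algebra {1..n})"] left_ideal
    by (auto simp: left_ideal_def left_ideal_generated_def assms(1))
  then have "I \<subseteq> word_space n gs"
    unfolding assms(1) by (intro left_ideal_generated_subset assms(2))
  also have "\<dots> \<subseteq> weyl_span ?W"
    unfolding word_space_def
    by (intro weyl.span_mono) (force simp: spanning_list_def)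
  finally have I: "I \<subseteq> weyl_span ?W" .
  have D: "\<partial> i * P \<in> weyl_span ?W" if "i \<in> {1..m}" "P \<in> weyl_algebra {1..n}" for i P
  proof -
    let ?V = "operator_of ` (\<Union>k. set (words n [one_terms n] k)) :: 'k weyl set"
    have "\<partial> i * b \<in> ?W" if b: "b \<in> ?V" for b
    proof -
      from b obtain u k where u: "b = operator_of u" "u \<in> set (words n [one_terms n] k)" by auto
      have "wf_terms n u" using u(2) by (induction rule: words_induct) (simp_all add: wf_one_terms)
      then have "\<partial> i * b = ?op (d_mult (i - 1) u, map (\<lambda>t. (i - 1, t)) u)"
        using \<open>i \<in> {1..m}\<close> assms(3) operator_of_d_mult[of n u "i - 1"] by (cases i) (simp_all add: u(1) Suc_le_eq)
      moreover have "(d_mult (i - 1) u, map (\<lambda>t. (i - 1, t)) u) \<in> set (spanning_list n m gs k)"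
        using u(2) \<open>i \<in> {1..m}\<close>
        by (auto simp: spanning_list_def intro!: disjI2 bexI[of _ "i - 1"] imageI)
      ultimately show ?thesis by blast
    qed
    then have "weyl_span ((\<lambda>b. \<partial> i * b) ` ?V) \<subseteq> weyl_span ?W"
      by (intro weyl.span_mono) blast
    moreover have "P \<in> weyl_span ?V"
      using weyl_algebra_subset_word_space that(2) by (auto simp: word_space_def)
    ultimately show ?thesis
      using weyl_span_image[of "\<lambda>b. \<partial> i * b" P ?V]
      by (auto simp: ring_distribs weyl_scale_mult_right)
  qed
  from assms(4) obtain a s where p: "p = a + s" "a \<in> I" "s \<in> (\<Sum>i=1..m. (\<lambda>P. \<partial> i * P) ` weyl_algebra {1..n})"
    by (auto simp: integration_ideal_def elim: set_plus_elim)
  then obtain t where "s = (\<Sum>i=1..m. t i)" "\<forall>i\<in>{1..m}. t i \<in> (\<lambda>P. \<partial> i * P) ` weyl_algebra {1..n}"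
    by (auto simp: set_sum_alt)
  then have "s \<in> weyl_span ?W"
    using D by (auto intro!: weyl.span_sum)
  then have "p \<in> weyl_span ?W"
    using I p by (auto intro: weyl.span_add)
  then have "\<exists>k. p \<in> weyl_span (?op ` set (spanning_list n m gs k))"
  proof (induction rule: weyl.span_induct_alt)
    case base
    then show ?case by (simp add: weyl.span_zero)
  next
    case (step c x y)
    \<comment> \<open>A linear combination involves finitely many levels, and the levels increase,
      so the maximum works.\<close>
    then obtain j k where "x \<in> ?op ` set (spanning_list n m gs j)"
      "y \<in> weyl_span (?op ` set (spanning_list n m gs k))" by blast
    then have "x \<in> weyl_span (?op ` set (spanning_list n m gs (max j k)))"
      "y \<in> weyl_span (?op ` set (spanning_list n m gs (max j k)))"
      using weyl.span_mono[OF image_mono[OF spanning_list_mono]] weyl.span_base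
      by (meson max.cobounded1 max.cobounded2 subsetD)+
    then show ?case by (blast intro: weyl.span_add weyl.span_scale)
  qed
  then show ?thesis using that by blast
qed

section \<open>Programs for the elimination\<close>

lemma computable_pred [comp_rules]:
  assumes "computable ea tree_of_nat f"
  shows "computable ea tree_of_nat (\<lambda>a. f a - 1)"
proof -
  have pred_eq: "j - 1 = length (tl (replicate j ()))" for j
    by simp
  show ?thesis
    unfolding pred_eq by (rule comp_rules computable_replicate_unit assms)+
qed

abbreviation "enc_key \<equiv> enc_prod (tree_of_list tree_of_nat) (tree_of_list tree_of_nat)"
abbreviation "enc_term \<equiv> enc_prod Scalar enc_key"
abbreviation "enc_terms \<equiv> tree_of_list enc_term"
abbreviation "enc_tagged \<equiv> enc_prod enc_terms (tree_of_list (enc_prod tree_of_nat enc_term))"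

lemma tree_of_terms_eq: "tree_of_terms = enc_terms"
  unfolding tree_of_terms_def by (rule arg_cong[of _ _ tree_of_list]) (auto simp: enc_prod_def fun_eq_iff)

lemma computable_key_eq [comp_rules]:
  assumes "computable ea enc_key f" "computable ea enc_key g"
  shows "computable ea enc_bool (\<lambda>a. f a = g a)"
  unfolding prod_eq_iff by (rule comp_rules assms)+

lemma computable_scale_terms [comp_rules]:
  assumes "computable ea Scalar c" "computable ea enc_terms f"
  shows "computable ea enc_terms (\<lambda>a. scale_terms (c a) (f a))"
  unfolding scale_terms_def by (rule comp_rules assms assms[THEN computable_comp])+

lemma computable_x_mult [comp_rules]:
  assumes "computable ea tree_of_nat i" "computable ea enc_terms f"
  shows "computable ea enc_terms (\<lambda>a. x_mult (i a) (f a))"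
  unfolding x_mult_def by (rule comp_rules assms assms[THEN computable_comp])+

lemma computable_d_mult [comp_rules]:
  assumes "computable ea tree_of_nat i" "computable ea enc_terms f"
  shows "computable ea enc_terms (\<lambda>a. d_mult (i a) (f a))"
  unfolding d_mult_def by (rule comp_rules assms assms[THEN computable_comp])+

lemma computable_coeff_terms [comp_rules]:
  assumes "computable ea enc_terms f" "computable ea enc_key g"
  shows "computable ea Scalar (\<lambda>a. coeff_terms (f a) (g a))"
proof -
  have sum_list_eq: "sum_list l = foldr (\<lambda>x s. x + s) l 0" for l :: "'b list"
    by (induction l) auto
  show ?thesis
    unfolding coeff_terms_def sum_list_eq by (rule comp_rules assms assms[THEN computable_comp])+
qed

lemma computable_pivots [comp_rules]:
  assumes "computable ea enc_terms f"
  shows "computable ea enc_terms (\<lambda>a. pivots (f a))"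
  unfolding pivots_def by (rule comp_rules assms assms[THEN computable_comp])+

lemma computable_component [comp_rules]:
  assumes "computable ea tree_of_nat i" "computable ea (tree_of_list (enc_prod tree_of_nat enc_term)) f"
  shows "computable ea enc_terms (\<lambda>a. component (i a) (f a))"
  unfolding component_def by (rule comp_rules assms assms[THEN computable_comp])+

lemma computable_add_scaled [comp_rules]:
  assumes "computable ea enc_tagged f" "computable ea Scalar c" "computable ea enc_tagged g"
  shows "computable ea enc_tagged (\<lambda>a. add_scaled (f a) (c a) (g a))"
  unfolding add_scaled_def by (rule comp_rules assms assms[THEN computable_comp])+

lemma computable_reduce [comp_rules]:
  assumes "computable ea enc_tagged f" "computable ea enc_tagged g"
  shows "computable ea enc_tagged (\<lambda>a. reduce (f a) (g a))"
  unfolding reduce_def by (rule comp_rules assms assms[THEN computable_comp])+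

lemma computable_eliminate [comp_rules]:
  assumes "computable ea (tree_of_list enc_tagged) f" "computable ea enc_tagged g"
  shows "computable ea enc_tagged (\<lambda>a. eliminate (f a) (g a))"
  unfolding eliminate_def elim_step_def by (rule comp_rules assms assms[THEN computable_comp])+

lemma computable_words [comp_rules]:
  assumes "computable ea tree_of_nat n" "computable ea (tree_of_list enc_terms) us" "computable ea tree_of_nat k"
  shows "computable ea (tree_of_list enc_terms) (\<lambda>a. words (n a) (us a) (k a))"
  unfolding words_def extend_words_def by (rule comp_rules assms assms[THEN computable_comp])+

lemma computable_one_terms [comp_rules]:
  assumes "computable ea tree_of_nat n"
  shows "computable ea enc_terms (\<lambda>a. one_terms (n a))"
  unfolding one_terms_def by (rule comp_rules assms)+

lemma computable_spanning_list [comp_rules]: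
  assumes "computable ea tree_of_nat n" "computable ea tree_of_nat m"
    and "computable ea (tree_of_list enc_terms) gs" "computable ea tree_of_nat k"
  shows "computable ea (tree_of_list enc_tagged) (\<lambda>a. spanning_list (n a) (m a) (gs a) (k a))"
  unfolding spanning_list_def by (rule comp_rules assms assms[THEN computable_comp])+

section \<open>The algorithm and its correctness\<close>

definition residual :: "nat \<times> nat \<times> 'k::field terms list \<times> 'k terms \<Rightarrow> nat \<Rightarrow> 'k tagged" where
  "residual x k = eliminate
     (spanning_list (fst x) (fst (snd x)) (fst (snd (snd x))) k) (snd (snd (snd x)), [])"

text \<open>The defect stays congruent to \<open>p\<close> modulo \<open>I\<close>. When the
  operator has become 0, the defect is minus the sum of the
  \<open>\<partial>\<^sub>i w\<^sub>i\<close>, hence the factor \<open>- 1\<close>.\<close>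

definition inhomogeneous_parts :: "nat \<times> nat \<times> 'k::field terms list \<times> 'k terms \<Rightarrow> nat \<Rightarrow> 'k terms list" where
  "inhomogeneous_parts x k = map (\<lambda>i. scale_terms (- 1) (component i (snd (residual x k)))) [0..<fst (snd x)]"

abbreviation "enc_input \<equiv>
  enc_prod tree_of_nat (enc_prod tree_of_nat (enc_prod (tree_of_list enc_terms) enc_terms))"

lemma computable_residual:
  "computable (enc_prod tree_of_nat enc_input) enc_tagged (\<lambda>p. residual (snd p) (fst p))"
  unfolding residual_def by (rule comp_rules)+

lemma inhomogeneous_parts_computable:
  "\<exists>A. \<forall>(n::nat) (m::nat) (I :: 'k::field weyl set) G gs p ps.
     1 \<le> m \<and> m \<le> n \<and>
     holonomic_ideal n I \<and>
     I = left_ideal_generated (weyl_algebra {1..n}) (set G) \<and>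
     list_all2 (represents n) gs G \<and>
     p \<in> integration_ideal n m I \<and>
     represents n ps p \<longrightarrow>
     (\<exists>q qs. list_all2 (represents n) qs (map q [1..<m+1]) \<and>
        computes A (tree_of_input n m gs ps) (tree_of_list tree_of_terms qs) \<and>
        p - (\<Sum>i=1..m. \<partial> i * q i) \<in> I)"
proof -
  have "computable (enc_prod tree_of_nat enc_input) enc_bool (\<lambda>p. pivots (fst (residual (snd p) (fst p))) = [])"
    by (rule comp_rules computable_residual)+
  moreover have "computable (enc_prod tree_of_nat enc_input) (tree_of_list enc_terms)
      (\<lambda>p. inhomogeneous_parts (snd p) (fst p))"
    unfolding inhomogeneous_parts_def by (rule comp_rules computable_residual computable_residual[THEN computable_comp])+
  ultimately obtain A where A: "\<And>x :: nat \<times> nat \<times> 'k terms list \<times> 'k terms.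
      \<exists>k. pivots (fst (residual x k)) = [] \<Longrightarrow>
      \<exists>k. pivots (fst (residual x k)) = [] \<and> computes A (enc_input x) (tree_of_list enc_terms (inhomogeneous_parts x k))"
    by (rule computable_search) (rule that, blast)
  show ?thesis
  proof (intro exI[of _ A] allI impI, elim conjE)
    fix n m :: nat and I :: "'k weyl set" and G gs p ps
    assume m: "1 \<le> m" "m \<le> n" and hol: "holonomic_ideal n I"
      and I: "I = left_ideal_generated (weyl_algebra {1..n}) (set G)"
      and gs: "list_all2 (represents n) gs G"
      and p: "p \<in> integration_ideal n m I" "represents n ps p"
    interpret weyl_left_ideal n I
      using hol by unfold_locales (simp add: holonomic_ideal_def)
    define x where "x = (n, m, gs, ps)"
    have G: "wf_terms n g \<and> operator_of g \<in> I" if "g \<in> set gs" for g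
    proof -
      have "set G \<subseteq> I"
        unfolding I left_ideal_generated_def by (rule hull_subset)
      then show ?thesis
        using list_all2_represents[OF gs] that by auto
    qed
    have ps: "wf_tagged n (ps, [])" "defect m (ps, []) = p" "operator_of (fst (ps, [])) = p"
      using p(2) by (simp_all add: represents_iff wf_tagged_def defect_def component_def)
    have wf: "wf_tagged n (residual x k)" and sound: "defect m (residual x k) - p \<in> I" for k
      using eliminate_sound[of "spanning_list n m gs k" m "(ps, [])"] spanning_list_sound[OF G m(2)] ps
      by (auto simp: residual_def x_def)
    from spanning_list_complete[OF I gs m(2) p(1)] obtain k
      where "p \<in> weyl_span ((\<lambda>v. operator_of (fst v)) ` set (spanning_list n m gs k))" .
    then have "operator_of (fst (residual x k)) = 0"
      unfolding residual_def x_def fst_conv snd_conv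
      using spanning_list_sound[OF G m(2)] ps by (intro eliminate_complete) auto
    then have "\<exists>k. pivots (fst (residual x k)) = []"
      using pivots_eq_Nil_iff wf[of k] by (auto simp: wf_tagged_def)
    \<comment> \<open>The search may stop at another level than the one just found; soundness holds
      at every level, so a zero remainder is enough.\<close>
    from A[OF this] obtain k where k: "pivots (fst (residual x k)) = []"
      and run: "computes A (enc_input x) (tree_of_list enc_terms (inhomogeneous_parts x k))" by blast
    \<comment> \<open>Parts are numbered from 1, tags from 0.\<close>
    define q where "q i = - operator_of (component (i - 1) (snd (residual x k)))" for i
    have "wf_terms n (component i (snd (residual x k)))" for i
      using wf[of k] by (auto simp: wf_tagged_def wf_terms_def component_def)
    then have rep: "list_all2 (represents n) (inhomogeneous_parts x k) (map q [1..<m+1])"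
      by (auto simp: list_all2_conv_all_nth inhomogeneous_parts_def x_def represents_iff q_def simp del: upt_Suc)
    have "operator_of (fst (residual x k)) = 0"
      using k wf[of k] pivots_eq_Nil_iff by (auto simp: wf_tagged_def)
    moreover have "(\<Sum>i=1..m. \<partial> i * q i) = (\<Sum>i<m. \<partial> (Suc i) * q (Suc i))"
      by (rule sum.reindex_bij_witness[of _ Suc "\<lambda>i. i - 1"]) auto
    ultimately have "defect m (residual x k) = (\<Sum>i=1..m. \<partial> i * q i)"
      by (simp add: defect_def q_def sum_negf)
    then have "p - (\<Sum>i=1..m. \<partial> i * q i) \<in> I"
      using uminus_mem[OF sound[of k]] by simp
    moreover have "tree_of_input n m gs ps = enc_input x"
      by (simp add: tree_of_input_def enc_prod_def x_def tree_of_terms_eq)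
    ultimately show "\<exists>q qs. list_all2 (represents n) qs (map q [1..<m+1]) \<and>
        computes A (tree_of_input n m gs ps) (tree_of_list tree_of_terms qs) \<and>
        p - (\<Sum>i=1..m. \<partial> i * q i) \<in> I"
      using rep run unfolding tree_of_terms_eq by (intro exI conjI) simp_all
  qed
qed

theorem theorem1:
  shows
    "(\<exists>A. \<forall>(n::nat) (m::nat) (I :: rat weyl set) G gs p ps.
       1 \<le> m \<and> m \<le> n \<and>
       holonomic_ideal n I \<and>
       I = left_ideal_generated (weyl_algebra {1..n}) (set G) \<and>
       list_all2 (represents n) gs G \<and>
       p \<in> integration_ideal n m I \<and>
       represents n ps p \<longrightarrow>
       (\<exists>q qs. list_all2 (represents n) qs (map q [1..<m+1]) \<and>
          computes A (tree_of_input n m gs ps) (tree_of_list tree_of_terms qs) \<and>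
          p - (\<Sum>i=1..m. \<partial> i * q i) \<in> I))
     \<and>
     (\<exists>A. \<forall>(n::nat) (m::nat) (I :: complex weyl set) G gs p ps.
       1 \<le> m \<and> m \<le> n \<and>
       holonomic_ideal n I \<and>
       I = left_ideal_generated (weyl_algebra {1..n}) (set G) \<and>
       list_all2 (represents n) gs G \<and>
       p \<in> integration_ideal n m I \<and>
       represents n ps p \<longrightarrow>
       (\<exists>q qs. list_all2 (represents n) qs (map q [1..<m+1]) \<and>
          computes A (tree_of_input n m gs ps) (tree_of_list tree_of_terms qs) \<and>
          p - (\<Sum>i=1..m. \<partial> i * q i) \<in> I))"
  by (rule conjI; rule inhomogeneous_parts_computable)

end
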